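(* Let $g(\cdot,t)=u(\cdot,t)\,ds_p^2$, $t\in(-\infty,0)$, be an ancient solution of the Ricci flow $\partial_t g_{ij}=-2R_{ij}$ on $S^2$ which becomes singular at time $t=0$, where $u>0$ is smooth on $S^2\times(-\infty,0)$ and satisfies $u_t=\Delta_{S^2}\log u-2$ in $S^2\times(-\infty,0)$. Let $v=u^{-1}$. Assume that the coordinates $(\psi,\theta)$ on $S^2$ are chosen such that $\lim_{t\to-\infty}v(\psi,\theta,t)=C_0\cos^2\psi$ for all $|\psi|\le\pi/2$, $0\le\theta\le 2\pi$, with a constant $C_0>0$, and that there exist constants $0<a<3$, $T_0<0$ and $C>0$ such that $$v_\theta^2\le C\,v^{1+a}\cos^2\psi\quad\text{on } S^2\times(-\infty,T_0].$$ Then for any $|\psi|\le\pi/2$ and $t<0$, $u(\psi,\theta,t)$ is independent of $\theta\in[0,2\pi]$.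
   Context: $ds_p^2=d\psi^2+\cos^2\psi\,d\theta^2$ is the standard round metric on the unit sphere $S^2$ with latitude-longitude coordinates $(\psi,\theta)$, $-\pi/2\le\psi\le\pi/2$, $0\le\theta\le 2\pi$; the poles are $\psi=\pm\pi/2$. $\Delta_{S^2}$ is its Laplacian, $\Delta_{S^2}f=f_{\psi\psi}-(\tan\psi)f_\psi+(\sec^2\psi)f_{\theta\theta}$. "Ancient" means defined for all $t<0$. By known results, $v(\cdot,t)$ decreases as $t\to-\infty$ and converges in $C^{1,\alpha}(S^2)$ for every $0<\alpha<1$; after a conformal change of $S^2$ the limit has the form $C_0\cos^2\psi$ with $C_0\ge 0$, and the assumption on the coordinates refers to this normalization. *)

theory Defs
  imports "HOL-Analysis.Analysis"
begin

section \<open>Smooth functions\<close>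

fun C_diff_on :: "nat \<Rightarrow> ('a::euclidean_space \<Rightarrow> real) \<Rightarrow> 'a set \<Rightarrow> bool" where
  "C_diff_on 0 f W \<longleftrightarrow> continuous_on W f"
| "C_diff_on (Suc k) f W \<longleftrightarrow>
     f differentiable_on W \<and> (\<forall>d. C_diff_on k (\<lambda>x. frechet_derivative f (at x) d) W)"

text \<open>
  Smoothness on an arbitrary subset of Euclidean space: local extendability to a smooth function
  on an open set. On an embedded submanifold this is the smoothness of the manifold.
\<close>

definition smooth_on :: "('a::euclidean_space \<Rightarrow> real) \<Rightarrow> 'a set \<Rightarrow> bool" where
  "smooth_on f M \<longleftrightarrow>
     (\<forall>p\<in>M. \<exists>W F. open W \<and> p \<in> W \<and> (\<forall>k. C_diff_on k F W) \<and> (\<forall>x\<in>M \<inter> W. F x = f x))"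


section \<open>Ricci curvature and Ricci flow in local coordinates\<close>

definition coord_partial :: "'n::finite \<Rightarrow> (real^'n \<Rightarrow> real) \<Rightarrow> real^'n \<Rightarrow> real" where
  "coord_partial k f x = deriv (\<lambda>h. f (x + h *\<^sub>R axis k 1)) 0"

definition christoffel ::
  "(real^'n \<Rightarrow> real^'n^'n) \<Rightarrow> 'n \<Rightarrow> 'n::finite \<Rightarrow> 'n \<Rightarrow> real^'n \<Rightarrow> real"
  \<comment> \<open>the upper index is the first one\<close> where
  "christoffel G k i j x =
     (\<Sum>l\<in>UNIV. matrix_inv (G x) $ k $ l *
        (coord_partial i (\<lambda>y. G y $ j $ l) x + coord_partial j (\<lambda>y. G y $ i $ l) x
          - coord_partial l (\<lambda>y. G y $ i $ j) x)) / 2"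

text \<open>The sign is such that round spheres have positive Ricci curvature.\<close>

definition ricci :: "(real^'n \<Rightarrow> real^'n^'n) \<Rightarrow> real^'n \<Rightarrow> real^'n::finite^'n" where
  "ricci G x = (\<chi> i j.
     (\<Sum>k\<in>UNIV. coord_partial k (christoffel G k i j) x - coord_partial j (christoffel G k i k) x)
     + (\<Sum>k\<in>UNIV. \<Sum>l\<in>UNIV. christoffel G k k l x * christoffel G l i j x
                           - christoffel G k j l x * christoffel G l i k x))"

definition ricci_flow_on ::
  "(real \<Rightarrow> real^'n \<Rightarrow> real^'n::finite^'n) \<Rightarrow> (real^'n) set \<Rightarrow> real set \<Rightarrow> bool" where
  "ricci_flow_on G U J \<longleftrightarrow>
     (\<forall>t\<in>J. \<forall>x\<in>U. ((\<lambda>s. G s x) has_vector_derivative (-2) *\<^sub>R ricci (G t) x) (at t))"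


section \<open>The unit sphere in latitude-longitude coordinates\<close>

definition S2 :: "(real^3) set" where
  "S2 = sphere 0 1"

definition latlon :: "real \<Rightarrow> real \<Rightarrow> real^3" where
  "latlon \<psi> \<theta> = vector [cos \<psi> * cos \<theta>, cos \<psi> * sin \<theta>, sin \<psi>]"

definition S2_laplacian :: "(real \<Rightarrow> real \<Rightarrow> real) \<Rightarrow> real \<Rightarrow> real \<Rightarrow> real" where
  "S2_laplacian f \<psi> \<theta> =
     deriv (deriv (\<lambda>s. f s \<theta>)) \<psi> - tan \<psi> * deriv (\<lambda>s. f s \<theta>) \<psi>
     + (1 / cos \<psi>)\<^sup>2 * deriv (deriv (\<lambda>s. f \<psi> s)) \<theta>"

text \<open>Coordinate vectors are \<open>x = (\<psi>, \<theta>)\<close>.\<close>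

definition round_metric :: "real^2 \<Rightarrow> real^2^2" where
  "round_metric x = vector [vector [1, 0], vector [0, (cos (x $ 1))\<^sup>2]]"

definition conformal_metric :: "(real^3 \<Rightarrow> real \<Rightarrow> real) \<Rightarrow> real \<Rightarrow> real^2 \<Rightarrow> real^2^2" where
  "conformal_metric u t x = u (latlon (x $ 1) (x $ 2)) t *\<^sub>R round_metric x"

text \<open>
  The coordinates degenerate exactly at the two poles; there the flow equation follows
  from the equation elsewhere by continuity.
\<close>

definition S2_ricci_flow :: "(real^3 \<Rightarrow> real \<Rightarrow> real) \<Rightarrow> real \<Rightarrow> bool"
  \<comment> \<open>the conformal metrics with factor \<open>u\<close> form a smooth Ricci flow on the sphere for
      all times before \<open>T\<close>\<close> where
  "S2_ricci_flow u T \<longleftrightarrow>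
     smooth_on (\<lambda>(p, t). u p t) (S2 \<times> {..<T}) \<and>
     (\<forall>p\<in>S2. \<forall>t<T. u p t > 0) \<and>
     ricci_flow_on (conformal_metric u) {x. \<bar>x $ 1\<bar> < pi / 2} {..<T}"

text \<open>
  The flow becomes singular at time \<open>T\<close> if it has no smooth continuation beyond \<open>T\<close>. In
  dimension two the Ricci flow preserves the conformal class pointwise, so it is enough to
  consider continuations of the conformal factor.
\<close>

definition becomes_singular_at :: "(real^3 \<Rightarrow> real \<Rightarrow> real) \<Rightarrow> real \<Rightarrow> bool" where
  "becomes_singular_at u T \<longleftrightarrow>
     \<not> (\<exists>T'>T. \<exists>w. S2_ricci_flow w T' \<and> (\<forall>p\<in>S2. \<forall>t<T. w p t = u p t))"

end

(*
  The conformal factor solves u_t = Delta log u - 2 on the sphere, and for two solutions the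
  integral of (u1 - u2)_+ is nonincreasing in time: formally, multiply the difference of the
  equations by the indicator function of u1 > u2, that is, of log u1 > log u2.

  The equation is invariant under the parabolic rescaling l u(t0 + (t - t0) / l). Comparing u with
  its rescalings and letting t0 tend to -infinity shows that u is nonincreasing in t, hence
  u <= 1 / (C0 cos^2 psi). With the assumption on v_theta this gives
  |u_theta| <= K (cos psi)^(a - 2) for t <= T0, which is integrable for the measure
  cos psi dpsi dtheta because a > 0. As t tends to -infinity, u(psi, theta + h) - u(psi, theta)
  tends to 0 away from the poles, so by dominated convergence the integral of its positive part
  tends to 0. This integral is nonincreasing in t, hence it vanishes for all t.
*)
theory Submission
  imports Defs
begin

section \<open>Calculus of \<open>C_diff_on\<close>\<close>

text \<open>The exponent \<open>a - 2\<close> arises as follows. Since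
  \<open>u_\<theta> = - u^2 v_\<theta>\<close>, the hypothesis reads
  \<open>u_\<theta>^2 <= C u^(3 - a) cos^2 \<psi>\<close>. For \<open>a < 3\<close> the bound on
  \<open>u\<close> may be inserted, which leaves \<open>cos \<psi>\<close> to the power
  \<open>2 - 2 (3 - a) = 2 (a - 2)\<close>. With the area weight the oscillation of \<open>u\<close>
  is of order \<open>cos^(a - 1) \<psi>\<close>, integrable exactly for \<open>a > 0\<close>. The
  convergence of \<open>v\<close> is only assumed pointwise; monotonicity in time is what makes the
  majorant uniform in time. The formal argument for the contraction meets two obstacles. The
  indicator function must be regularised, but the time derivative falls on \<open>u1 - u2\<close>
  and the Laplacian on \<open>log u1 - log u2\<close>, so two different regularisations are used and
  compared in the limit. And the coordinates degenerate at the poles: the equation is therefore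
  multiplied by \<open>cos \<psi>\<close>, and \<open>u\<close> is regarded as a function of all
  real \<open>\<psi>\<close> and \<open>\<theta>\<close>, smooth also where \<open>latlon\<close> is
  not a chart.\<close>

lemma frechet_derivative_cong_open:
  assumes "open S" "x \<in> S" "\<And>y. y \<in> S \<Longrightarrow> f y = g y"
  shows "frechet_derivative f (at x) = frechet_derivative g (at x)"
proof -
  have "(f has_derivative D) (at x) \<longleftrightarrow> (g has_derivative D) (at x)" for D
    using has_derivative_transform_within_open[OF _ assms(1,2)] assms(3) by metis
  then show ?thesis by (simp add: frechet_derivative_def)
qed

lemma frechet_derivative_eqI:
  "(f has_derivative D) (at x) \<Longrightarrow> frechet_derivative f (at x) = D"
  using frechet_derivative_at by fastforce

lemma C_diff_on_subset:
  assumes "C_diff_on k f S" "T \<subseteq> S"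
  shows "C_diff_on k f T"
  using assms
proof (induction k arbitrary: f)
  case 0
  then show ?case using continuous_on_subset by auto
next
  case (Suc k)
  then show ?case using differentiable_on_subset by auto
qed

lemma C_diff_on_cong:
  assumes "open S" "\<And>x. x \<in> S \<Longrightarrow> f x = g x" "C_diff_on k f S"
  shows "C_diff_on k g S"
  using assms(2,3)
proof (induction k arbitrary: f g)
  case 0
  then show ?case using continuous_on_cong by auto
next
  case (Suc k)
  have "f differentiable_on S" using Suc.prems by simp
  then have "g differentiable_on S"
    unfolding differentiable_on_def differentiable_def
    using has_derivative_transform[of _ S g f] Suc.prems(1) by metis
  moreover have "C_diff_on k (\<lambda>x. frechet_derivative g (at x) d) S" for d
  proof (rule Suc.IH)
    show "frechet_derivative f (at x) d = frechet_derivative g (at x) d" if "x \<in> S" for x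
      using frechet_derivative_cong_open[OF assms(1) that Suc.prems(1)] by simp
    show "C_diff_on k (\<lambda>x. frechet_derivative f (at x) d) S" using Suc.prems by simp
  qed
  ultimately show ?case by simp
qed

text \<open>\<open>smooth_on\<close> provides an extension near each point only, possibly a
  different one at each point, so the smoothness of the conformal factor in coordinates has to be
  assembled locally.\<close>

lemma C_diff_on_local:
  assumes "\<And>x. x \<in> S \<Longrightarrow> \<exists>T. open T \<and> x \<in> T \<and> C_diff_on k f T"
  shows "C_diff_on k f S"
  using assms
proof (induction k arbitrary: f)
  case 0
  have "isCont f x" if "x \<in> S" for x
    using 0[OF that] continuous_on_eq_continuous_at by auto
  then show ?case by (simp add: continuous_at_imp_continuous_on)
next
  case (Suc k)
  have "f differentiable_on S"
    unfolding differentiable_on_def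
  proof
    fix x assume "x \<in> S"
    then obtain T where "open T" "x \<in> T" "f differentiable_on T"
      using Suc.prems by (metis C_diff_on.simps(2))
    then have "f differentiable at x" by (simp add: differentiable_on_eq_differentiable_at)
    then show "f differentiable at x within S" by (rule differentiable_at_withinI)
  qed
  moreover have "C_diff_on k (\<lambda>x. frechet_derivative f (at x) d) S" for d
  proof (rule Suc.IH)
    fix x assume "x \<in> S"
    then show "\<exists>T. open T \<and> x \<in> T \<and> C_diff_on k (\<lambda>x. frechet_derivative f (at x) d) T"
      using Suc.prems by (metis C_diff_on.simps(2))
  qed
  ultimately show ?case by simp
qed

text \<open>The recursion of \<open>C_diff_on\<close> refers to \<open>frechet_derivative\<close>.
  On an open set a derivative given by a formula coincides with it, so the closure properties below
  only have to supply such a formula \<open>D\<close>.\<close>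

lemma C_diff_on_SucI:
  assumes "open S"
    and "\<And>x. x \<in> S \<Longrightarrow> (f has_derivative D x) (at x)"
    and "\<And>d. C_diff_on k (\<lambda>x. D x d) S"
  shows "C_diff_on (Suc k) f S"
proof -
  have "f differentiable_on S"
    using assms(1,2) differentiableI differentiable_on_eq_differentiable_at by blast
  moreover have "C_diff_on k (\<lambda>x. frechet_derivative f (at x) d) S" for d
    by (rule C_diff_on_cong[OF assms(1) _ assms(3)[of d]]) (simp add: frechet_derivative_eqI[OF assms(2)])
  ultimately show ?thesis by simp
qed

lemma C_diff_on_SucD:
  assumes "open S" "C_diff_on (Suc k) f S"
  shows "x \<in> S \<Longrightarrow> (f has_derivative frechet_derivative f (at x)) (at x)"
    and "C_diff_on k (\<lambda>x. frechet_derivative f (at x) d) S"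
  using assms differentiable_on_eq_differentiable_at by (auto simp: frechet_derivative_works)

lemma C_diff_on_lower: "C_diff_on (Suc k) f S \<Longrightarrow> C_diff_on k f S"
proof (induction k arbitrary: f)
  case 0
  then show ?case by (simp add: differentiable_imp_continuous_on)
next
  case (Suc k)
  have "C_diff_on k (\<lambda>x. frechet_derivative f (at x) d) S" for d
    by (rule Suc.IH) (use Suc.prems in simp)
  then show ?case using Suc.prems by simp
qed

lemma C_diff_on_const [simp]: "open S \<Longrightarrow> C_diff_on k (\<lambda>x. c) S"
proof (induction k arbitrary: c)
  case (Suc k)
  show ?case by (rule C_diff_on_SucI[where D = "\<lambda>x d. 0"]) (use Suc in auto)
qed simp

lemma C_diff_on_bounded_linear:
  assumes "open S" "bounded_linear f"
  shows "C_diff_on k f S"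
proof (cases k)
  case 0
  then show ?thesis using assms by (simp add: linear_continuous_on)
next
  case (Suc m)
  show ?thesis unfolding Suc
    by (rule C_diff_on_SucI[where D = "\<lambda>x. f"])
      (use assms bounded_linear.has_derivative[OF assms(2) has_derivative_ident] in auto)
qed

lemma C_diff_on_add:
  assumes "open S" "C_diff_on k f S" "C_diff_on k g S"
  shows "C_diff_on k (\<lambda>x. f x + g x) S"
  using assms(2,3)
proof (induction k arbitrary: f g)
  case 0
  then show ?case by (auto intro: continuous_intros)
next
  case (Suc k)
  show ?case
  proof (rule C_diff_on_SucI[OF assms(1)])
    show "((\<lambda>x. f x + g x) has_derivative
      (\<lambda>d. frechet_derivative f (at x) d + frechet_derivative g (at x) d)) (at x)" if "x \<in> S" for x
      using C_diff_on_SucD(1)[OF assms(1)] Suc.prems that by (intro has_derivative_add) auto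
    show "C_diff_on k (\<lambda>x. frechet_derivative f (at x) d + frechet_derivative g (at x) d) S" for d
      using Suc by auto
  qed
qed

lemma C_diff_on_mult:
  assumes "open S" "C_diff_on k f S" "C_diff_on k g S"
  shows "C_diff_on k (\<lambda>x. f x * g x) S"
  using assms(2,3)
proof (induction k arbitrary: f g)
  case 0
  then show ?case by (auto intro: continuous_intros)
next
  case (Suc k)
  show ?case
  proof (rule C_diff_on_SucI[OF assms(1)])
    show "((\<lambda>x. f x * g x) has_derivative
      (\<lambda>d. f x * frechet_derivative g (at x) d + frechet_derivative f (at x) d * g x)) (at x)"
      if "x \<in> S" for x
      using C_diff_on_SucD(1)[OF assms(1)] Suc.prems that by (intro has_derivative_mult) auto
    show "C_diff_on k (\<lambda>x. f x * frechet_derivative g (at x) d + frechet_derivative f (at x) d * g x) S" for d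
      using C_diff_on_lower[OF Suc.prems(1)] C_diff_on_lower[OF Suc.prems(2)] Suc.prems
      by (intro C_diff_on_add Suc.IH assms(1)) auto
  qed
qed

lemma C_diff_on_sum:
  assumes "open S" "\<And>i. i \<in> I \<Longrightarrow> C_diff_on k (f i) S"
  shows "C_diff_on k (\<lambda>x. \<Sum>i\<in>I. f i x) S"
  using assms(2) by (induction I rule: infinite_finite_induct) (auto simp: assms(1) C_diff_on_add)

text \<open>By the chain rule the derivative of the composition in direction \<open>d\<close> is a
  sum over the basis: a derivative of a component of \<open>h\<close> times a partial derivative of
  \<open>F\<close>, composed again with \<open>h\<close>. Hence the induction runs over all
  \<open>F\<close> with \<open>h\<close> fixed.\<close>

lemma C_diff_on_compose:
  fixes h :: "'a::euclidean_space \<Rightarrow> 'b::euclidean_space"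
  assumes "open S" "open T" "h ` S \<subseteq> T"
    and "C_diff_on k F T" "\<And>b. b \<in> Basis \<Longrightarrow> C_diff_on k (\<lambda>x. h x \<bullet> b) S"
  shows "C_diff_on k (\<lambda>x. F (h x)) S"
  using assms(4,5)
proof (induction k arbitrary: F)
  case 0
  have "continuous_on S h" using 0 by (subst continuous_on_componentwise) auto
  then show ?case using 0 assms(3) continuous_on_compose2 by (metis C_diff_on.simps(1))
next
  case (Suc k)
  define D where "D x d = (\<Sum>b\<in>Basis. frechet_derivative (\<lambda>x. h x \<bullet> b) (at x) d *\<^sub>R b)" for x d
  have D: "(h has_derivative D x) (at x)" if "x \<in> S" for x
  proof (subst has_derivative_componentwise_within, intro ballI)
    fix b :: 'b assume b: "b \<in> Basis"
    have "(\<lambda>d. D x d \<bullet> b) = frechet_derivative (\<lambda>x. h x \<bullet> b) (at x)"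
      using b by (auto simp: D_def inner_sum_left inner_Basis if_distrib cong: if_cong)
    then show "((\<lambda>x. h x \<bullet> b) has_derivative (\<lambda>d. D x d \<bullet> b)) (at x)"
      using C_diff_on_SucD(1)[OF assms(1) Suc.prems(2)[OF b] that] by simp
  qed
  show ?case
  proof (rule C_diff_on_SucI[OF assms(1)])
    fix x assume x: "x \<in> S"
    have F: "(F has_derivative frechet_derivative F (at (h x))) (at (h x))"
      using C_diff_on_SucD(1)[OF assms(2) Suc.prems(1)] x assms(3) by auto
    have "((\<lambda>x. F (h x)) has_derivative (\<lambda>d. frechet_derivative F (at (h x)) (D x d))) (at x)"
      using has_derivative_compose[OF D[OF x] F] .
    moreover have "frechet_derivative F (at (h x)) (D x d) =
      (\<Sum>b\<in>Basis. frechet_derivative (\<lambda>x. h x \<bullet> b) (at x) d * frechet_derivative F (at (h x)) b)" for d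
      unfolding D_def using has_derivative_linear[OF F] by (simp add: linear_sum linear_scale)
    ultimately show "((\<lambda>x. F (h x)) has_derivative (\<lambda>d. \<Sum>b\<in>Basis.
        frechet_derivative (\<lambda>x. h x \<bullet> b) (at x) d * frechet_derivative F (at (h x)) b)) (at x)"
      by (simp only:)
  next
    fix d
    show "C_diff_on k (\<lambda>x. \<Sum>b\<in>Basis.
        frechet_derivative (\<lambda>x. h x \<bullet> b) (at x) d * frechet_derivative F (at (h x)) b) S"
    proof (intro C_diff_on_sum C_diff_on_mult assms(1))
      fix b :: 'b assume b: "b \<in> Basis"
      show "C_diff_on k (\<lambda>x. frechet_derivative (\<lambda>x. h x \<bullet> b) (at x) d) S"
        using Suc.prems(2)[OF b] by simp
      show "C_diff_on k (\<lambda>x. frechet_derivative F (at (h x)) b) S"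
      proof (rule Suc.IH)
        show "C_diff_on k (\<lambda>x. frechet_derivative F (at x) b) T" using Suc.prems(1) by simp
        show "C_diff_on k (\<lambda>x. h x \<bullet> b) S" if "b \<in> Basis" for b
          by (rule C_diff_on_lower[OF Suc.prems(2)[OF that]])
      qed
    qed
  qed
qed

lemma C_diff_on_compose_real:
  fixes h :: "'a::euclidean_space \<Rightarrow> real"
  assumes "open S" "open T" "h ` S \<subseteq> T" "C_diff_on k F T" "C_diff_on k h S"
  shows "C_diff_on k (\<lambda>x. F (h x)) S"
  by (rule C_diff_on_compose[OF assms(1-4)]) (use assms(5) in auto)

text \<open>A joint induction, because each function is the derivative of the other up to
  sign.\<close>

lemma C_diff_on_sin_cos:
  "C_diff_on k (sin :: real \<Rightarrow> real) UNIV \<and> C_diff_on k (cos :: real \<Rightarrow> real) UNIV"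
proof (induction k)
  case 0
  show ?case by (auto intro: continuous_intros)
next
  case (Suc k)
  have "C_diff_on (Suc k) (sin :: real \<Rightarrow> real) UNIV"
  proof (rule C_diff_on_SucI[where D = "\<lambda>x d. cos x * d"])
    show "C_diff_on k (\<lambda>x. cos x * d) UNIV" for d :: real
      using Suc by (intro C_diff_on_mult) auto
  qed (auto intro!: derivative_eq_intros)
  moreover have "C_diff_on (Suc k) (cos :: real \<Rightarrow> real) UNIV"
  proof (rule C_diff_on_SucI[where D = "\<lambda>x d. sin x * (- d)"])
    show "C_diff_on k (\<lambda>x. sin x * (- d)) UNIV" for d :: real
      using Suc by (intro C_diff_on_mult) auto
  qed (auto intro!: derivative_eq_intros)
  ultimately show ?case by simp
qed

lemma C_diff_on_inverse: "C_diff_on k (inverse :: real \<Rightarrow> real) {0<..}"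
proof (induction k)
  case 0
  show ?case by (auto intro!: continuous_intros)
next
  case (Suc k)
  show ?case
  \<comment> \<open>Written with copies of \<open>inverse\<close> itself, so that the induction
    hypothesis applies to each factor.\<close>
  proof (rule C_diff_on_SucI[where D = "\<lambda>x d. (inverse x * inverse x) * (- d)"])
    show "C_diff_on k (\<lambda>x. (inverse x * inverse x) * (- d)) {0<..}" for d :: real
      using Suc by (intro C_diff_on_mult) auto
  qed (auto intro!: derivative_eq_intros simp: power2_eq_square)
qed

lemma C_diff_on_ln: "C_diff_on k (ln :: real \<Rightarrow> real) {0<..}"
proof (cases k)
  case 0
  then show ?thesis by (auto intro!: continuous_intros)
next
  case (Suc m)
  show ?thesis unfolding Suc
  proof (rule C_diff_on_SucI[where D = "\<lambda>x d. inverse x * d"])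
    show "C_diff_on m (\<lambda>x. inverse x * d) {0<..}" for d :: real
      using C_diff_on_inverse by (intro C_diff_on_mult) auto
  qed (auto intro!: derivative_eq_intros simp: divide_simps)
qed

section \<open>Integration by parts on the sphere\<close>

lemma DERIV_max_0_square:
  "((\<lambda>x::real. (max 0 x)\<^sup>2) has_real_derivative 2 * max 0 x) (at x)"
proof -
  consider "x > 0" | "x < 0" | "x = 0" by linarith
  then show ?thesis
  proof cases
    case 1
    have "((\<lambda>x::real. x\<^sup>2) has_real_derivative 2 * max 0 x) (at x)"
      using 1 by (auto intro!: derivative_eq_intros)
    then show ?thesis
      by (rule has_field_derivative_transform_within_open[where S = "{0<..}"]) (use 1 in auto)
  next
    case 2
    have "((\<lambda>x::real. 0) has_real_derivative 2 * max 0 x) (at x)"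
      using 2 by (auto intro!: derivative_eq_intros)
    then show ?thesis
      by (rule has_field_derivative_transform_within_open[where S = "{..<0}"]) (use 2 in auto)
  next
    case 3
    have "((\<lambda>h::real. (max 0 h)\<^sup>2 / h) \<longlongrightarrow> 0) (at 0)"
    proof (rule Lim_null_comparison[where g = "\<lambda>h. \<bar>h\<bar>"])
      show "\<forall>\<^sub>F h in at 0. norm ((max 0 h)\<^sup>2 / h) \<le> \<bar>h::real\<bar>"
        by (intro always_eventually) (auto simp: max_def power2_eq_square)
      show "((\<lambda>h::real. \<bar>h\<bar>) \<longlongrightarrow> 0) (at 0)"
        by (rule tendsto_rabs_zero) (rule tendsto_ident_at)
    qed
    then show ?thesis using 3 by (simp add: DERIV_def)
  qed
qed

text \<open>As \<open>e\<close> tends to 0, a monotone approximation with values in [0, 1] of the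
  indicator function of the positive numbers. Squaring \<open>max 0 x\<close> removes the corner at
  0, so it can serve as \<open>p\<close> in the integration by parts.\<close>

definition smooth_step :: "real \<Rightarrow> real \<Rightarrow> real" where
  "smooth_step e x = (max 0 x)\<^sup>2 / ((max 0 x)\<^sup>2 + e)"

lemma DERIV_smooth_step:
  assumes "e > 0"
  shows "(smooth_step e has_real_derivative 2 * max 0 x * e / ((max 0 x)\<^sup>2 + e)\<^sup>2) (at x)"
proof -
  have "(max 0 x)\<^sup>2 + e \<noteq> 0" using assms by (smt (verit) zero_le_power2)
  then have "((\<lambda>x. (max 0 x)\<^sup>2 / ((max 0 x)\<^sup>2 + e)) has_real_derivative
      (2 * max 0 x * ((max 0 x)\<^sup>2 + e) - (max 0 x)\<^sup>2 * (2 * max 0 x + 0)) /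
      (((max 0 x)\<^sup>2 + e) * ((max 0 x)\<^sup>2 + e))) (at x)"
    by (intro DERIV_divide DERIV_add DERIV_max_0_square DERIV_const)
  then show ?thesis
    unfolding smooth_step_def by (simp add: algebra_simps power2_eq_square)
qed

lemma smooth_step_deriv_nonneg: "e > 0 \<Longrightarrow> 0 \<le> 2 * max 0 (x::real) * e / ((max 0 x)\<^sup>2 + e)\<^sup>2"
  by simp

lemma smooth_step_bounds: "e > 0 \<Longrightarrow> 0 \<le> smooth_step e x \<and> smooth_step e x \<le> 1"
  using add_nonneg_pos[of "(max 0 x)\<^sup>2" e] by (auto simp: smooth_step_def divide_simps)

lemma continuous_on_smooth_step: "e > 0 \<Longrightarrow> continuous_on S (smooth_step e)"
  using DERIV_smooth_step DERIV_isCont continuous_at_imp_continuous_on by metis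

lemma smooth_step_limit:
  "(\<lambda>n. smooth_step (1 / real (Suc n)) x) \<longlonglongrightarrow> (if x > 0 then 1 else 0)"
proof (cases "x > 0")
  case True
  have "(\<lambda>n. x\<^sup>2 / (x\<^sup>2 + 1 / real (Suc n))) \<longlonglongrightarrow> x\<^sup>2 / (x\<^sup>2 + 0)"
    using True by (intro tendsto_intros LIMSEQ_Suc[OF lim_1_over_n]) auto
  then show ?thesis using True by (simp add: smooth_step_def max_def)
next
  case False
  then show ?thesis by (simp add: smooth_step_def max_def)
qed

text \<open>A regularised positive part, constant for negative arguments. Its derivative
  \<open>max 0 x / smooth_ramp e x\<close> is a second approximation of the same indicator
  function.\<close>

definition smooth_ramp :: "real \<Rightarrow> real \<Rightarrow> real" where
  "smooth_ramp e x = sqrt ((max 0 x)\<^sup>2 + e)"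

lemma DERIV_smooth_ramp:
  assumes "e > 0"
  shows "(smooth_ramp e has_real_derivative max 0 x / smooth_ramp e x) (at x)"
proof -
  have "(max 0 x)\<^sup>2 + e > 0" using assms by (smt (verit) zero_le_power2)
  then have "((\<lambda>x. sqrt ((max 0 x)\<^sup>2 + e)) has_real_derivative
      inverse (sqrt ((max 0 x)\<^sup>2 + e)) / 2 * (2 * max 0 x + 0)) (at x)"
    by (intro DERIV_chain2[OF DERIV_real_sqrt] DERIV_add DERIV_max_0_square DERIV_const)
  then show ?thesis
    unfolding smooth_ramp_def by (simp add: field_simps)
qed

lemma smooth_ramp_pos: "e > 0 \<Longrightarrow> smooth_ramp e x > 0"
  by (simp add: smooth_ramp_def add_nonneg_pos)

lemma smooth_ramp_ge: "e > 0 \<Longrightarrow> max 0 x \<le> smooth_ramp e x"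
  unfolding smooth_ramp_def by (rule real_le_rsqrt) simp

lemma continuous_on_smooth_ramp [continuous_intros]:
  "continuous_on S f \<Longrightarrow> continuous_on S (\<lambda>x. smooth_ramp e (f x))"
  unfolding smooth_ramp_def by (intro continuous_intros)

lemma smooth_ramp_limit: "(\<lambda>n. smooth_ramp (1 / real (Suc n)) x) \<longlonglongrightarrow> max 0 x"
proof -
  have "(\<lambda>n. sqrt ((max 0 x)\<^sup>2 + 1 / real (Suc n))) \<longlonglongrightarrow> sqrt ((max 0 x)\<^sup>2 + 0)"
    by (intro tendsto_intros LIMSEQ_Suc[OF lim_1_over_n])
  then show ?thesis by (simp add: smooth_ramp_def)
qed

lemma smooth_ramp_deriv_limit:
  "(\<lambda>n. max 0 x / smooth_ramp (1 / real (Suc n)) x) \<longlonglongrightarrow> (if x > 0 then 1 else 0)"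
proof (cases "x > 0")
  case True
  have "(\<lambda>n. max 0 x / smooth_ramp (1 / real (Suc n)) x) \<longlonglongrightarrow> max 0 x / max 0 x"
    using True by (intro tendsto_intros smooth_ramp_limit) auto
  then show ?thesis using True by simp
qed (simp add: max_def)

section \<open>Integration by parts in one variable and over the latitude-longitude
  rectangle\<close>

lemma continuous_on_slice:
  assumes "continuous_on (A \<times> B) f" "x \<in> A"
  shows "continuous_on B (\<lambda>y. f (x, y))"
  by (rule continuous_on_compose2[OF assms(1)]) (use assms(2) in \<open>auto intro!: continuous_intros\<close>)

lemma continuous_on_slice':
  assumes "continuous_on (A \<times> B) f" "y \<in> B"
  shows "continuous_on A (\<lambda>x. f (x, y))"
  by (rule continuous_on_compose2[OF assms(1)]) (use assms(2) in \<open>auto intro!: continuous_intros\<close>)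

text \<open>The endpoints carry no measure. This matters because the equation in coordinates
  contains a division by \<open>cos \<psi>\<close> and is available between the poles only.\<close>

lemma integral_le_interior:
  fixes f g :: "real \<Rightarrow> real"
  assumes "continuous_on {a..b} f" "continuous_on {a..b} g"
    and "\<And>x. x \<in> {a<..<b} \<Longrightarrow> f x \<le> g x"
  shows "integral {a..b} f \<le> integral {a..b} g"
proof -
  have "f integrable_on {a<..<b}" "g integrable_on {a<..<b}"
    using assms(1,2) by (simp_all add: integrable_on_open_interval_real integrable_continuous_real)
  from integral_le[OF this assms(3)] show ?thesis
    by (simp add: integral_open_interval_real)
qed

text \<open>Fundamental theorem for the product of \<open>f\<close> and \<open>p\<close> of
  \<open>w\<close>: its derivative exceeds the integrand by a term that \<open>sgn\<close> makes
  nonnegative, and \<open>bdry\<close> controls the boundary values. In the applications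
  \<open>f\<close> is a nonnegative multiple of \<open>w'\<close>, so that this term is a square
  times nonnegative factors.\<close>

lemma integral_mult_le_by_parts:
  fixes w f f' :: "real \<Rightarrow> real"
  assumes "a \<le> b"
    and w: "\<And>x. x \<in> {a..b} \<Longrightarrow> (w has_real_derivative w' x) (at x)"
    and f: "\<And>x. x \<in> {a..b} \<Longrightarrow> (f has_real_derivative f' x) (at x)"
    and p: "\<And>y. (p has_real_derivative p' y) (at y)"
    and sgn: "\<And>x. x \<in> {a..b} \<Longrightarrow> 0 \<le> f x * p' (w x) * w' x"
    and cont: "continuous_on {a..b} f'"
    and bdry: "f b * p (w b) \<le> f a * p (w a)"
  shows "integral {a..b} (\<lambda>x. f' x * p (w x)) \<le> 0"
proof -
  have 1: "((\<lambda>x. f' x * p (w x) + f x * p' (w x) * w' x) has_integral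
      f b * p (w b) - f a * p (w a)) {a..b}"
  proof (rule fundamental_theorem_of_calculus[OF assms(1)])
    fix x assume x: "x \<in> {a..b}"
    have "((\<lambda>x. f x * p (w x)) has_real_derivative f' x * p (w x) + f x * p' (w x) * w' x) (at x)"
      using DERIV_mult[OF f[OF x] DERIV_chain2[OF p w[OF x]]] by (simp add: mult_ac)
    then show "((\<lambda>x. f x * p (w x)) has_vector_derivative
        f' x * p (w x) + f x * p' (w x) * w' x) (at x within {a..b})"
      by (simp add: has_real_derivative_iff_has_vector_derivative has_vector_derivative_at_within)
  qed
  have 2: "((\<lambda>x. f' x * p (w x)) has_integral integral {a..b} (\<lambda>x. f' x * p (w x))) {a..b}"
  proof (intro integrable_integral integrable_continuous_real continuous_intros cont)
    show "continuous_on {a..b} (\<lambda>x. p (w x))"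
      using DERIV_isCont[OF DERIV_chain2[OF p w]] continuous_at_imp_continuous_on by blast
  qed
  have "integral {a..b} (\<lambda>x. f' x * p (w x)) \<le> f b * p (w b) - f a * p (w a)"
    by (rule has_integral_le[OF 2 1]) (use sgn in simp)
  then show ?thesis using bdry by simp
qed

text \<open>
  The weight \<open>cos \<psi>\<close> vanishes at the poles, which is why integration by parts in \<open>\<psi>\<close> leaves no
  boundary terms, whatever the boundary values of \<open>W\<close>.
\<close>

lemma sphere_integral_by_parts:
  fixes W Wp Wpp Wq Wqq E :: "real \<times> real \<Rightarrow> real"
  defines "K \<equiv> {-pi/2..pi/2} \<times> {0..2*pi}"
  assumes cont: "continuous_on K W" "continuous_on K Wp" "continuous_on K Wpp"
      "continuous_on K Wqq" "continuous_on K E"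
    and Wp: "\<And>\<psi> \<theta>. (\<psi>, \<theta>) \<in> K \<Longrightarrow> ((\<lambda>s. W (s, \<theta>)) has_real_derivative Wp (\<psi>, \<theta>)) (at \<psi>)"
    and Wpp: "\<And>\<psi> \<theta>. (\<psi>, \<theta>) \<in> K \<Longrightarrow> ((\<lambda>s. Wp (s, \<theta>)) has_real_derivative Wpp (\<psi>, \<theta>)) (at \<psi>)"
    and Wq: "\<And>\<psi> \<theta>. (\<psi>, \<theta>) \<in> K \<Longrightarrow> ((\<lambda>s. W (\<psi>, s)) has_real_derivative Wq (\<psi>, \<theta>)) (at \<theta>)"
    and Wqq: "\<And>\<psi> \<theta>. (\<psi>, \<theta>) \<in> K \<Longrightarrow> ((\<lambda>s. Wq (\<psi>, s)) has_real_derivative Wqq (\<psi>, \<theta>)) (at \<theta>)"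
    and per: "\<And>\<psi>. W (\<psi>, 2*pi) = W (\<psi>, 0)" "\<And>\<psi>. Wq (\<psi>, 2*pi) = Wq (\<psi>, 0)"
    and E: "\<And>\<psi> \<theta>. \<bar>\<psi>\<bar> < pi/2 \<Longrightarrow> \<theta> \<in> {0..2*pi} \<Longrightarrow>
        E (\<psi>, \<theta>) = cos \<psi> * Wpp (\<psi>, \<theta>) - sin \<psi> * Wp (\<psi>, \<theta>) + Wqq (\<psi>, \<theta>) / cos \<psi>"
    and p: "\<And>y. (p has_real_derivative p' y) (at y)" "\<And>y. p' y \<ge> 0"
  shows "integral K (\<lambda>x. E x * p (W x)) \<le> 0"
proof -
  have K: "K = cbox (-pi/2, 0) (pi/2, 2*pi)" by (simp add: K_def cbox_Pair_eq)
  \<comment> \<open>The contribution of the \<open>\<psi>\<close> derivatives. It is continuous up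
    to the poles, and it is all that remains once the \<open>Wqq\<close> term has been integrated
    over \<open>\<theta>\<close>, with \<open>1 / cos \<psi>\<close> a positive constant there, and
    dropped because of its sign.\<close>
  define G where "G x = (cos (fst x) * Wpp x - sin (fst x) * Wp x) * p (W x)" for x
  have contp: "continuous_on UNIV p"
    using DERIV_isCont[OF p(1)] continuous_at_imp_continuous_on by blast
  have cpW: "continuous_on K (\<lambda>x. p (W x))"
    by (rule continuous_on_compose2[OF contp cont(1)]) auto
  have cEp: "continuous_on K (\<lambda>x. E x * p (W x))"
    by (intro continuous_intros cont cpW)
  have cG: "continuous_on K G"
    unfolding G_def by (intro continuous_intros cont cpW)
  have cG2: "continuous_on (cbox (-pi/2, 0) (pi/2, 2*pi)) (\<lambda>(\<psi>, \<theta>). G (\<psi>, \<theta>))"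
    using cG by (simp add: K)
  have cqq: "continuous_on K (\<lambda>x. Wqq x * p (W x))"
    by (intro continuous_intros cont cpW)
  have sl: "continuous_on {0..2*pi} (\<lambda>\<theta>. f (\<psi>, \<theta>))"
    if "continuous_on K f" "\<psi> \<in> {-pi/2..pi/2}" for f :: "real \<times> real \<Rightarrow> real" and \<psi>
    using continuous_on_slice that unfolding K_def by blast
  have cint: "continuous_on {-pi/2..pi/2} (\<lambda>\<psi>. integral {0..2*pi} (\<lambda>\<theta>. f (\<psi>, \<theta>)))"
    if "continuous_on K f" for f :: "real \<times> real \<Rightarrow> real"
    using integral_continuous_on_param[of "{-pi/2..pi/2}" 0 "2*pi" "\<lambda>\<psi> \<theta>. f (\<psi>, \<theta>)"] that
    by (simp add: K_def)
  have le: "integral {0..2*pi} (\<lambda>\<theta>. E (\<psi>, \<theta>) * p (W (\<psi>, \<theta>))) \<le> integral {0..2*pi} (\<lambda>\<theta>. G (\<psi>, \<theta>))"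
    if "\<psi> \<in> {-pi/2<..<pi/2}" for \<psi>
  proof -
    have \<psi>: "\<psi> \<in> {-pi/2..pi/2}" "\<bar>\<psi>\<bar> < pi/2" and c: "cos \<psi> > 0"
      using that by (auto intro: cos_gt_zero_pi)
    have "integral {0..2*pi} (\<lambda>\<theta>. E (\<psi>, \<theta>) * p (W (\<psi>, \<theta>))) =
      integral {0..2*pi} (\<lambda>\<theta>. G (\<psi>, \<theta>) + (Wqq (\<psi>, \<theta>) * p (W (\<psi>, \<theta>))) / cos \<psi>)"
      by (intro integral_cong) (simp add: E[OF \<psi>(2)] G_def algebra_simps)
    also have "\<dots> = integral {0..2*pi} (\<lambda>\<theta>. G (\<psi>, \<theta>)) +
        integral {0..2*pi} (\<lambda>\<theta>. Wqq (\<psi>, \<theta>) * p (W (\<psi>, \<theta>))) / cos \<psi>"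
      using sl[OF cG \<psi>(1)] sl[OF cqq \<psi>(1)] c
      by (subst integral_add) (auto intro!: integrable_continuous_real continuous_intros)
    also have "\<dots> \<le> integral {0..2*pi} (\<lambda>\<theta>. G (\<psi>, \<theta>))"
    proof -
      have "integral {0..2*pi} (\<lambda>\<theta>. Wqq (\<psi>, \<theta>) * p (W (\<psi>, \<theta>))) \<le> 0"
      proof (rule integral_mult_le_by_parts[where w = "\<lambda>\<theta>. W (\<psi>, \<theta>)" and w' = "\<lambda>\<theta>. Wq (\<psi>, \<theta>)"
            and f = "\<lambda>\<theta>. Wq (\<psi>, \<theta>)" and f' = "\<lambda>\<theta>. Wqq (\<psi>, \<theta>)" and p = p and p' = p'])
        show "0 \<le> Wq (\<psi>, \<theta>) * p' (W (\<psi>, \<theta>)) * Wq (\<psi>, \<theta>)" for \<theta>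
        proof -
          have "0 \<le> p' (W (\<psi>, \<theta>)) * (Wq (\<psi>, \<theta>))\<^sup>2" using p(2) by simp
          then show ?thesis by (simp add: power2_eq_square mult_ac)
        qed
      qed (use \<psi> Wq Wqq p(1) per sl[OF cont(4) \<psi>(1)] in \<open>auto simp: K_def\<close>)
      then show ?thesis using c by (simp add: divide_nonpos_pos)
    qed
    finally show ?thesis .
  qed
  have "integral K (\<lambda>x. E x * p (W x)) =
      integral {-pi/2..pi/2} (\<lambda>\<psi>. integral {0..2*pi} (\<lambda>\<theta>. E (\<psi>, \<theta>) * p (W (\<psi>, \<theta>))))"
    using integral_prod_continuous[OF cEp[unfolded K]] by (simp add: K)
  also have "\<dots> \<le> integral {-pi/2..pi/2} (\<lambda>\<psi>. integral {0..2*pi} (\<lambda>\<theta>. G (\<psi>, \<theta>)))"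
    by (rule integral_le_interior[OF cint[OF cEp] cint[OF cG] le])
  \<comment> \<open>Integration by parts in \<open>\<psi>\<close> takes place at fixed
    \<open>\<theta>\<close>, hence the exchange of the order of integration.\<close>
  also have "\<dots> = integral {0..2*pi} (\<lambda>\<theta>. integral {-pi/2..pi/2} (\<lambda>\<psi>. G (\<psi>, \<theta>)))"
    by (rule integral_swap_continuous[OF cG2, unfolded box_real])
  also have "\<dots> \<le> 0"
  proof -
    have "integral {-pi/2..pi/2} (\<lambda>\<psi>. G (\<psi>, \<theta>)) \<le> 0" if \<theta>: "\<theta> \<in> {0..2*pi}" for \<theta>
      unfolding G_def fst_conv
    proof (rule integral_mult_le_by_parts[where w = "\<lambda>\<psi>. W (\<psi>, \<theta>)" and w' = "\<lambda>\<psi>. Wp (\<psi>, \<theta>)"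
          and f = "\<lambda>\<psi>. cos \<psi> * Wp (\<psi>, \<theta>)"
          and f' = "\<lambda>\<psi>. cos \<psi> * Wpp (\<psi>, \<theta>) - sin \<psi> * Wp (\<psi>, \<theta>)" and p = p and p' = p'])
      fix \<psi> :: real assume \<psi>: "\<psi> \<in> {-pi/2..pi/2}"
      then have "cos \<psi> \<ge> 0" by (auto intro: cos_ge_zero)
      then have "0 \<le> cos \<psi> * p' (W (\<psi>, \<theta>)) * (Wp (\<psi>, \<theta>))\<^sup>2"
        using p(2) by simp
      then show "0 \<le> cos \<psi> * Wp (\<psi>, \<theta>) * p' (W (\<psi>, \<theta>)) * Wp (\<psi>, \<theta>)"
        by (simp add: power2_eq_square mult_ac)
      show "((\<lambda>\<psi>. cos \<psi> * Wp (\<psi>, \<theta>)) has_real_derivative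
          cos \<psi> * Wpp (\<psi>, \<theta>) - sin \<psi> * Wp (\<psi>, \<theta>)) (at \<psi>)"
        using \<psi> \<theta> by (auto intro!: derivative_eq_intros Wpp simp: K_def)
    next
      have "continuous_on {-pi/2..pi/2} (\<lambda>\<psi>. Wpp (\<psi>, \<theta>))" "continuous_on {-pi/2..pi/2} (\<lambda>\<psi>. Wp (\<psi>, \<theta>))"
        using continuous_on_slice'[OF _ \<theta>] cont(2,3) unfolding K_def by blast+
      then show "continuous_on {-pi/2..pi/2} (\<lambda>\<psi>. cos \<psi> * Wpp (\<psi>, \<theta>) - sin \<psi> * Wp (\<psi>, \<theta>))"
        by (intro continuous_intros)
    qed (use \<theta> Wp p(1) in \<open>auto simp: K_def\<close>)
    moreover have "continuous_on {0..2*pi} (\<lambda>\<theta>. integral {-pi/2..pi/2} (\<lambda>\<psi>. G (\<psi>, \<theta>)))"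
    proof -
      have "continuous_on ({0..2*pi} \<times> {-pi/2..pi/2}) (\<lambda>(\<theta>, \<psi>). G (\<psi>, \<theta>))"
        using swap_continuous[OF cG2] by (simp add: cbox_Pair_eq)
      then show ?thesis
        using integral_continuous_on_param[of "{0..2*pi}" "-pi/2" "pi/2" "\<lambda>\<theta> \<psi>. G (\<psi>, \<theta>)"] by simp
    qed
    ultimately have "integral {0..2*pi} (\<lambda>\<theta>. integral {-pi/2..pi/2} (\<lambda>\<psi>. G (\<psi>, \<theta>))) \<le> integral {0..2*pi} (\<lambda>\<theta>. 0)"
      by (intro integral_le integrable_continuous_real) auto
    then show ?thesis by simp
  qed
  finally show ?thesis .
qed

section \<open>Decrease of the integrated positive part of a difference\<close>

lemma smooth_ramp_le: "0 < e \<Longrightarrow> e \<le> 1 \<Longrightarrow> smooth_ramp e x \<le> \<bar>x\<bar> + 1"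
proof -
  assume e: "0 < e" "e \<le> 1"
  have "(max 0 x)\<^sup>2 \<le> \<bar>x\<bar>\<^sup>2" by (intro power_mono) auto
  then have "(max 0 x)\<^sup>2 + e \<le> (\<bar>x\<bar> + 1)\<^sup>2" using e by (simp add: power2_sum)
  then show ?thesis unfolding smooth_ramp_def by (intro real_le_lsqrt) auto
qed

lemma smooth_ramp_deriv_bounds:
  assumes "e > 0"
  shows "0 \<le> max 0 x / smooth_ramp e x \<and> max 0 x / smooth_ramp e x \<le> 1"
  using smooth_ramp_pos[OF assms, of x] smooth_ramp_ge[OF assms, of x] by (auto simp: divide_simps)

text \<open>
  Testing the equation with \<open>smooth_step\<close> of \<open>W\<close> produces a sign, testing it with the
  derivative of \<open>smooth_ramp\<close> at \<open>D\<close> produces an exact time derivative. Both test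
  functions tend to the indicator function of \<open>D > 0\<close>.
\<close>

lemma positive_part_integral_decreasing:
  fixes D Dt W Wp Wpp Wq Wqq :: "real \<times> real \<times> real \<Rightarrow> real"
  defines "B \<equiv> {-pi/2..pi/2} \<times> {0..2*pi}"
  assumes "t0 \<le> t1"
    and cont: "continuous_on ({t0..t1} \<times> B) D" "continuous_on ({t0..t1} \<times> B) Dt"
      "continuous_on ({t0..t1} \<times> B) W" "continuous_on ({t0..t1} \<times> B) Wp"
      "continuous_on ({t0..t1} \<times> B) Wpp" "continuous_on ({t0..t1} \<times> B) Wqq"
    and Dt: "\<And>t x. t \<in> {t0..t1} \<Longrightarrow> x \<in> B \<Longrightarrow> ((\<lambda>s. D (s, x)) has_real_derivative Dt (t, x)) (at t)"
    and Wp: "\<And>t \<psi> \<theta>. t \<in> {t0..t1} \<Longrightarrow> (\<psi>, \<theta>) \<in> B \<Longrightarrow>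
        ((\<lambda>s. W (t, s, \<theta>)) has_real_derivative Wp (t, \<psi>, \<theta>)) (at \<psi>)"
    and Wpp: "\<And>t \<psi> \<theta>. t \<in> {t0..t1} \<Longrightarrow> (\<psi>, \<theta>) \<in> B \<Longrightarrow>
        ((\<lambda>s. Wp (t, s, \<theta>)) has_real_derivative Wpp (t, \<psi>, \<theta>)) (at \<psi>)"
    and Wq: "\<And>t \<psi> \<theta>. t \<in> {t0..t1} \<Longrightarrow> (\<psi>, \<theta>) \<in> B \<Longrightarrow>
        ((\<lambda>s. W (t, \<psi>, s)) has_real_derivative Wq (t, \<psi>, \<theta>)) (at \<theta>)"
    and Wqq: "\<And>t \<psi> \<theta>. t \<in> {t0..t1} \<Longrightarrow> (\<psi>, \<theta>) \<in> B \<Longrightarrow>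
        ((\<lambda>s. Wq (t, \<psi>, s)) has_real_derivative Wqq (t, \<psi>, \<theta>)) (at \<theta>)"
    and per: "\<And>t \<psi>. t \<in> {t0..t1} \<Longrightarrow> W (t, \<psi>, 2*pi) = W (t, \<psi>, 0)"
      "\<And>t \<psi>. t \<in> {t0..t1} \<Longrightarrow> Wq (t, \<psi>, 2*pi) = Wq (t, \<psi>, 0)"
    and eq: "\<And>t \<psi> \<theta>. t \<in> {t0..t1} \<Longrightarrow> \<bar>\<psi>\<bar> < pi/2 \<Longrightarrow> \<theta> \<in> {0..2*pi} \<Longrightarrow>
        cos \<psi> * Dt (t, \<psi>, \<theta>) = cos \<psi> * Wpp (t, \<psi>, \<theta>) - sin \<psi> * Wp (t, \<psi>, \<theta>)
          + Wqq (t, \<psi>, \<theta>) / cos \<psi>"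
    and sgn: "\<And>t x. t \<in> {t0..t1} \<Longrightarrow> x \<in> B \<Longrightarrow> D (t, x) > 0 \<longleftrightarrow> W (t, x) > 0"
  shows "integral B (\<lambda>x. cos (fst x) * max 0 (D (t1, x)))
    \<le> integral B (\<lambda>x. cos (fst x) * max 0 (D (t0, x)))"
proof -
  define K where "K = {t0..t1} \<times> B"
  have B: "B = cbox (-pi/2, 0) (pi/2, 2*pi)" by (simp add: B_def cbox_Pair_eq)
  have K: "K = cbox (t0, -pi/2, 0) (t1, pi/2, 2*pi)" by (simp add: K_def B_def cbox_Pair_eq)
  have intB: "f integrable_on B" if "continuous_on B f" for f :: "real \<times> real \<Rightarrow> real"
    using that unfolding B by (rule integrable_continuous)
  have intK: "f integrable_on K" if "continuous_on K f" for f :: "real \<times> real \<times> real \<Rightarrow> real"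
    using that unfolding K by (rule integrable_continuous)
  note cont = cont[folded K_def]
  \<comment> \<open>The left-hand side of the equation is chosen as the integrand, since it is
    visibly continuous up to the poles.\<close>
  define E where "E x = cos (fst (snd x)) * Dt x" for x
  have cE: "continuous_on K E" unfolding E_def by (intro continuous_intros cont)
  have "compact K" unfolding K by (rule compact_cbox)
  then have "bounded (E ` K)" "bounded (D ` K)"
    using cE cont(1) compact_continuous_image compact_imp_bounded by blast+
  then obtain M N where M: "\<And>x. x \<in> K \<Longrightarrow> \<bar>E x\<bar> \<le> M" and N: "\<And>x. x \<in> K \<Longrightarrow> \<bar>D x\<bar> \<le> N"
    unfolding bounded_iff by (metis image_eqI real_norm_def)
  define e where "e n = 1 / real (Suc n)" for n
  have e: "e n > 0" "e n \<le> 1" for n by (auto simp: e_def)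
  define f where "f n x = E x * smooth_step (e n) (W x)" for n x
  define g where "g n x = E x * (max 0 (D x) / smooth_ramp (e n) (D x))" for n x
  define F where "F x = E x * (if D x > 0 then 1 else 0)" for x
  have cf: "continuous_on K (f n)" for n
    unfolding f_def
    by (intro continuous_intros cE continuous_on_compose2[OF continuous_on_smooth_step[OF e(1)] cont(3)]) auto
  have cg: "continuous_on K (g n)" for n
    unfolding g_def
    by (intro continuous_intros cE cont) (use smooth_ramp_pos[OF e(1)] in \<open>auto simp: less_le\<close>)
  have E1: "\<bar>E x * y\<bar> \<le> M" if "x \<in> K" "0 \<le> y \<and> y \<le> 1" for x y
  proof -
    have "\<bar>E x * y\<bar> = \<bar>E x\<bar> * y" using that(2) by (simp add: abs_mult)
    also have "\<dots> \<le> \<bar>E x\<bar> * 1" using that(2) by (intro mult_left_mono) auto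
    finally show ?thesis using M[OF that(1)] by simp
  qed
  have limf: "(\<lambda>n. integral K (f n)) \<longlonglongrightarrow> integral K F"
  proof (rule dominated_convergence(2)[where h = "\<lambda>x. M"])
    show "(\<lambda>n. f n x) \<longlonglongrightarrow> F x" if "x \<in> K" for x
    proof -
      have "D x > 0 \<longleftrightarrow> W x > 0" using sgn that by (auto simp: K_def)
      then show "(\<lambda>n. f n x) \<longlonglongrightarrow> F x"
        unfolding f_def F_def e_def using tendsto_mult[OF tendsto_const smooth_step_limit] by simp
    qed
    show "norm (f n x) \<le> M" if "x \<in> K" for n x
      unfolding f_def real_norm_def using E1[OF that smooth_step_bounds[OF e(1)]] .
  qed (auto intro: intK cf)
  have limg: "(\<lambda>n. integral K (g n)) \<longlonglongrightarrow> integral K F"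
  proof (rule dominated_convergence(2)[where h = "\<lambda>x. M"])
    show "(\<lambda>n. g n x) \<longlonglongrightarrow> F x" for x
      unfolding g_def F_def e_def by (intro tendsto_mult tendsto_const smooth_ramp_deriv_limit)
    show "norm (g n x) \<le> M" if "x \<in> K" for n x
      unfolding g_def real_norm_def using E1[OF that smooth_ramp_deriv_bounds[OF e(1)]] .
  qed (auto intro: intK cg)
  have "integral K (f n) \<le> 0" for n
  proof -
    have "integral K (f n) = integral {t0..t1} (\<lambda>t. integral B (\<lambda>x. f n (t, x)))"
      using integral_prod_continuous[OF cf[unfolded K]] by (simp add: K B)
    also have "\<dots> \<le> integral {t0..t1} (\<lambda>t. 0)"
    proof (rule integral_le)
      show "(\<lambda>t. integral B (\<lambda>x. f n (t, x))) integrable_on {t0..t1}"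
        using integral_continuous_on_param[of "{t0..t1}" "(-pi/2, 0)" "(pi/2, 2*pi)" "\<lambda>t x. f n (t, x)"]
          cf[of n] by (intro integrable_continuous_real) (simp add: K_def B)
      fix t assume t: "t \<in> {t0..t1}"
      have sl: "continuous_on B (\<lambda>x. h (t, x))" if "continuous_on K h" for h :: "real \<times> real \<times> real \<Rightarrow> real"
        using continuous_on_slice[OF that[unfolded K_def] t] .
      show "integral B (\<lambda>x. f n (t, x)) \<le> 0"
        unfolding f_def
      proof (rule sphere_integral_by_parts[where Wp = "\<lambda>x. Wp (t, x)" and Wpp = "\<lambda>x. Wpp (t, x)"
            and Wq = "\<lambda>x. Wq (t, x)" and Wqq = "\<lambda>x. Wqq (t, x)" and W = "\<lambda>x. W (t, x)"
            and E = "\<lambda>x. E (t, x)" and p = "smooth_step (e n)", folded B_def])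
        show "E (t, \<psi>, \<theta>) = cos \<psi> * Wpp (t, \<psi>, \<theta>) - sin \<psi> * Wp (t, \<psi>, \<theta>) + Wqq (t, \<psi>, \<theta>) / cos \<psi>"
          if "\<bar>\<psi>\<bar> < pi/2" "\<theta> \<in> {0..2*pi}" for \<psi> \<theta>
          using eq[OF t that] by (simp add: E_def)
      qed (use sl cont cE t Wp Wpp Wq Wqq per DERIV_smooth_step[OF e(1)] smooth_step_deriv_nonneg[OF e(1)]
            in simp_all)
    qed auto
    finally show ?thesis by simp
  qed
  then have "integral K F \<le> 0" using limf by (intro LIMSEQ_le_const2[OF limf]) auto
  \<comment> \<open>By the fundamental theorem in time, \<open>J n\<close> is the time integral of
    \<open>g n\<close>, which is the time derivative of
    \<open>cos \<psi> * smooth_ramp (e n) (D (t, x))\<close>.\<close>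
  define J where "J n x = cos (fst x) * (smooth_ramp (e n) (D (t1, x)) - smooth_ramp (e n) (D (t0, x)))" for n x
  have cD: "continuous_on B (\<lambda>x. D (t, x))" if "t \<in> {t0..t1}" for t
    using continuous_on_slice[OF cont(1)[unfolded K_def] that] .
  have tt: "t0 \<in> {t0..t1}" "t1 \<in> {t0..t1}" using assms(2) by auto
  have cJ: "continuous_on B (J n)" for n
    unfolding J_def by (intro continuous_intros cD tt)
  have "integral K (g n) = integral B (J n)" for n
  proof -
    have "integral K (g n) = integral {t0..t1} (\<lambda>t. integral B (\<lambda>x. g n (t, x)))"
      using integral_prod_continuous[OF cg[unfolded K]] by (simp add: K B)
    also have "\<dots> = integral B (\<lambda>x. integral {t0..t1} (\<lambda>t. g n (t, x)))"
    proof -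
      have "continuous_on (cbox (t0, (-pi/2, 0)) (t1, (pi/2, 2*pi))) (\<lambda>(t, x). g n (t, x))"
        using cg[of n] unfolding K by simp
      from integral_swap_continuous[OF this] show ?thesis by (simp only: B box_real)
    qed
    also have "\<dots> = integral B (J n)"
    proof (rule integral_cong)
      fix x assume x: "x \<in> B"
      have "((\<lambda>t. g n (t, x)) has_integral J n x) {t0..t1}"
      proof -
        have "((\<lambda>t. g n (t, x)) has_integral
          cos (fst x) * smooth_ramp (e n) (D (t1, x)) - cos (fst x) * smooth_ramp (e n) (D (t0, x))) {t0..t1}"
        proof (rule fundamental_theorem_of_calculus[OF assms(2)])
          fix t assume t: "t \<in> {t0..t1}"
          have "((\<lambda>t. cos (fst x) * smooth_ramp (e n) (D (t, x))) has_real_derivative g n (t, x)) (at t)"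
            using DERIV_cmult[OF DERIV_chain2[OF DERIV_smooth_ramp[OF e(1)] Dt[OF t x]], of "cos (fst x)"]
            by (simp add: g_def E_def mult_ac)
          then show "((\<lambda>t. cos (fst x) * smooth_ramp (e n) (D (t, x))) has_vector_derivative g n (t, x))
              (at t within {t0..t1})"
            by (simp add: has_real_derivative_iff_has_vector_derivative has_vector_derivative_at_within)
        qed
        then show ?thesis by (simp add: J_def right_diff_distrib)
      qed
      then show "integral {t0..t1} (\<lambda>t. g n (t, x)) = J n x" by (rule integral_unique)
    qed
    finally show ?thesis .
  qed
  moreover have "(\<lambda>n. integral B (J n)) \<longlonglongrightarrow>
      integral B (\<lambda>x. cos (fst x) * (max 0 (D (t1, x)) - max 0 (D (t0, x))))"
  \<comment> \<open>Since \<open>e n\<close> is at most 1, \<open>smooth_ramp\<close> stays below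
    \<open>N + 1\<close> for all \<open>n\<close>; one such term comes from each end of the time
    interval.\<close>
  proof (rule dominated_convergence(2)[where h = "\<lambda>x. (N + 1) + (N + 1)"])
    show "(\<lambda>n. J n x) \<longlonglongrightarrow> cos (fst x) * (max 0 (D (t1, x)) - max 0 (D (t0, x)))" for x
      unfolding J_def e_def by (intro tendsto_intros smooth_ramp_limit)
    fix n x assume x: "x \<in> B"
    have b: "\<bar>smooth_ramp (e n) (D (t, x))\<bar> \<le> N + 1" if "t \<in> {t0..t1}" for t
      using smooth_ramp_le[OF e, of n "D (t, x)"] smooth_ramp_pos[OF e(1), of n "D (t, x)"] N[of "(t, x)"] that x
      by (auto simp: K_def)
    have "\<bar>J n x\<bar> \<le> 1 * ((N + 1) + (N + 1))"
      unfolding J_def abs_mult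
      using b[OF tt(1)] b[OF tt(2)] by (intro mult_mono) auto
    then show "norm (J n x) \<le> (N + 1) + (N + 1)" by simp
  qed (auto intro: intB cJ)
  ultimately have "integral K F = integral B (\<lambda>x. cos (fst x) * (max 0 (D (t1, x)) - max 0 (D (t0, x))))"
    using LIMSEQ_unique[OF limg] by simp
  also have "\<dots> = integral B (\<lambda>x. cos (fst x) * max 0 (D (t1, x))) - integral B (\<lambda>x. cos (fst x) * max 0 (D (t0, x)))"
    unfolding right_diff_distrib
    by (intro integral_diff intB continuous_intros cD tt)
  finally show ?thesis using \<open>integral K F \<le> 0\<close> by simp
qed

section \<open>Contraction and comparison for ancient flows\<close>

lemma C_diff_on_partial:
  assumes "open S" "C_diff_on (Suc k) g S" "c s \<in> S"
    and "(c has_vector_derivative d) (at s)"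
  shows "((\<lambda>s. g (c s)) has_real_derivative frechet_derivative g (at (c s)) d) (at s)"
proof -
  have g: "(g has_derivative frechet_derivative g (at (c s))) (at (c s))"
    using C_diff_on_SucD(1)[OF assms(1,2,3)] .
  have "((\<lambda>s. g (c s)) has_derivative (\<lambda>h. frechet_derivative g (at (c s)) (h *\<^sub>R d))) (at s)"
    using has_derivative_compose[OF assms(4)[unfolded has_vector_derivative_def] g] .
  moreover have "frechet_derivative g (at (c s)) (h *\<^sub>R d) = frechet_derivative g (at (c s)) d * h" for h
    using linear_scale[OF has_derivative_linear[OF g]] by simp
  ultimately show ?thesis by (simp add: has_field_derivative_def)
qed

lemma C_diff_on_imp_continuous_on: "C_diff_on k f S \<Longrightarrow> continuous_on S f"
proof (induction k)
  case (Suc k)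
  then show ?case using C_diff_on_lower by blast
qed simp

text \<open>Differentiability is not an issue: \<open>deriv\<close> chooses among the derivatives at
  a point, and both sides have the same ones. With \<open>deriv_add_const\<close>, which rests on
  the same remark, this gives the invariance of \<open>S2_laplacian\<close> under rotations and
  under adding constants.\<close>

lemma deriv_shift: "deriv (\<lambda>s. f (s + c)) x = deriv f (x + c)"
  for f :: "real \<Rightarrow> real"
  by (simp add: deriv_def DERIV_shift)

lemma deriv_add_const: "deriv (\<lambda>s. c + f s) = deriv f"
  for f :: "real \<Rightarrow> real"
proof -
  have "((\<lambda>s. c + f s) has_real_derivative D) (at x) \<longleftrightarrow> (f has_real_derivative D) (at x)" for D x
    using DERIV_add[OF DERIV_const[of c], of f D x] DERIV_add[OF DERIV_const[of "-c"], of "\<lambda>s. c + f s" D x]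
    by auto
  then show ?thesis by (simp add: deriv_def fun_eq_iff)
qed

abbreviation past :: "(real \<times> real \<times> real) set" where
  "past \<equiv> {..<0} \<times> UNIV"

lemma open_past: "open past"
  by (simp add: open_Times)

text \<open>Points of \<^term>\<open>past\<close> are \<open>(t, \<psi>, \<theta>)\<close>.\<close>

definition ancient_flow :: "(real \<times> real \<times> real \<Rightarrow> real) \<Rightarrow> bool" where
  "ancient_flow U \<longleftrightarrow>
     C_diff_on 2 U past \<and>
     (\<forall>t<0. \<forall>x. U (t, x) > 0) \<and>
     (\<forall>t<0. \<forall>\<psi> \<theta>. U (t, \<psi>, \<theta> + 2*pi) = U (t, \<psi>, \<theta>)) \<and>
     (\<forall>t<0. \<forall>\<psi> \<theta>. \<bar>\<psi>\<bar> < pi/2 \<longrightarrow>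
        ((\<lambda>s. U (s, \<psi>, \<theta>)) has_real_derivative
          S2_laplacian (\<lambda>\<psi>' \<theta>'. ln (U (t, \<psi>', \<theta>'))) \<psi> \<theta> - 2) (at t))"

lemma ancient_flowD:
  assumes "ancient_flow U"
  shows "C_diff_on 2 U past" "\<And>t x. t < 0 \<Longrightarrow> U (t, x) > 0"
    "\<And>t \<psi> \<theta>. t < 0 \<Longrightarrow> U (t, \<psi>, \<theta> + 2*pi) = U (t, \<psi>, \<theta>)"
    "\<And>t \<psi> \<theta>. t < 0 \<Longrightarrow> \<bar>\<psi>\<bar> < pi/2 \<Longrightarrow>
        ((\<lambda>s. U (s, \<psi>, \<theta>)) has_real_derivative
          S2_laplacian (\<lambda>\<psi>' \<theta>'. ln (U (t, \<psi>', \<theta>'))) \<psi> \<theta> - 2) (at t)"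
    "continuous_on past U"
  using assms C_diff_on_imp_continuous_on unfolding ancient_flow_def by blast+

definition dir_deriv :: "real \<times> real \<times> real \<Rightarrow> (real \<times> real \<times> real \<Rightarrow> real) \<Rightarrow> real \<times> real \<times> real \<Rightarrow> real" where
  "dir_deriv d g x = frechet_derivative g (at x) d"

abbreviation "dt \<equiv> dir_deriv (1, 0, 0)"
abbreviation "d\<psi> \<equiv> dir_deriv (0, 1, 0)"
abbreviation "d\<theta> \<equiv> dir_deriv (0, 0, 1)"

lemma C_diff_on_dir_deriv: "C_diff_on (Suc k) g S \<Longrightarrow> C_diff_on k (dir_deriv d g) S"
  unfolding C_diff_on.simps dir_deriv_def[abs_def] by blast

lemma has_dir_deriv:
  assumes "C_diff_on (Suc k) g past" "t < 0"
  shows "((\<lambda>s. g (s, \<psi>, \<theta>)) has_real_derivative dt g (t, \<psi>, \<theta>)) (at t)"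
    and "((\<lambda>s. g (t, s, \<theta>)) has_real_derivative d\<psi> g (t, \<psi>, \<theta>)) (at \<psi>)"
    and "((\<lambda>s. g (t, \<psi>, s)) has_real_derivative d\<theta> g (t, \<psi>, \<theta>)) (at \<theta>)"
proof -
  have curve: "((\<lambda>s. (s, \<psi>, \<theta>)) has_vector_derivative (1, 0, 0)) (at t)"
    "((\<lambda>s. (t, s, \<theta>)) has_vector_derivative (0, 1, 0)) (at \<psi>)"
    "((\<lambda>s. (t, \<psi>, s)) has_vector_derivative (0, 0, 1)) (at \<theta>)"
    unfolding has_vector_derivative_def by (auto intro!: derivative_eq_intros simp: zero_prod_def)
  show "((\<lambda>s. g (s, \<psi>, \<theta>)) has_real_derivative dt g (t, \<psi>, \<theta>)) (at t)"
    "((\<lambda>s. g (t, s, \<theta>)) has_real_derivative d\<psi> g (t, \<psi>, \<theta>)) (at \<psi>)"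
    "((\<lambda>s. g (t, \<psi>, s)) has_real_derivative d\<theta> g (t, \<psi>, \<theta>)) (at \<theta>)"
    unfolding dir_deriv_def
    using assms C_diff_on_partial[OF open_past assms(1) _ curve(1)]
      C_diff_on_partial[OF open_past assms(1) _ curve(2)]
      C_diff_on_partial[OF open_past assms(1) _ curve(3)] by auto
qed

text \<open>Multiplication by \<open>cos \<psi>\<close> turns the first two terms of the Laplacian
  into the single derivative of \<open>cos \<psi> * d\<psi> L\<close> and removes the singularity of
  \<open>tan\<close>. The constant \<open>- 2 * cos \<psi>\<close> will cancel in the difference of
  two flows.\<close>

lemma ancient_flow_log:
  assumes "ancient_flow U"
  defines "L \<equiv> \<lambda>x. ln (U x)"
  shows "C_diff_on 2 L past"
    and "t < 0 \<Longrightarrow> d\<theta> L (t, \<psi>, 2*pi) = d\<theta> L (t, \<psi>, 0)"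
    and "t < 0 \<Longrightarrow> \<bar>\<psi>\<bar> < pi/2 \<Longrightarrow>
       cos \<psi> * dt U (t, \<psi>, \<theta>) = cos \<psi> * d\<psi> (d\<psi> L) (t, \<psi>, \<theta>) - sin \<psi> * d\<psi> L (t, \<psi>, \<theta>)
         + d\<theta> (d\<theta> L) (t, \<psi>, \<theta>) / cos \<psi> - 2 * cos \<psi>"
proof -
  note U = ancient_flowD[OF assms(1)]
  show CL2: "C_diff_on 2 L past"
    unfolding L_def
    by (rule C_diff_on_compose_real[OF open_past _ _ C_diff_on_ln]) (use U in auto)
  then have CL: "C_diff_on (Suc 1) L past" by (simp add: numeral_2_eq_2)
  have CU: "C_diff_on (Suc 1) U past" using U(1) by (simp add: numeral_2_eq_2)
  have C1: "C_diff_on (Suc 0) (dir_deriv d L) past" for d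
    using C_diff_on_dir_deriv[OF CL] by simp
  {
    fix t \<psi> \<theta> :: real assume t: "t < 0"
    have Ld: "deriv (\<lambda>s. L (t, s, \<theta>)) = (\<lambda>\<psi>. d\<psi> L (t, \<psi>, \<theta>))"
      "deriv (\<lambda>s. L (t, \<psi>, s)) = (\<lambda>\<theta>. d\<theta> L (t, \<psi>, \<theta>))" for \<psi> \<theta>
      using DERIV_imp_deriv[OF has_dir_deriv(2)[OF CL t]] DERIV_imp_deriv[OF has_dir_deriv(3)[OF CL t]]
      by auto
    show "d\<theta> L (t, \<psi>, 2*pi) = d\<theta> L (t, \<psi>, 0)"
    proof -
      have "d\<theta> L (t, \<psi>, 2*pi) = deriv (\<lambda>s. L (t, \<psi>, s)) (0 + 2*pi)" using Ld(2) by simp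
      also have "\<dots> = deriv (\<lambda>s. L (t, \<psi>, s + 2*pi)) 0" by (rule deriv_shift[symmetric])
      also have "\<dots> = deriv (\<lambda>s. L (t, \<psi>, s)) 0" using U(3)[OF t] by (simp add: L_def)
      finally show ?thesis using Ld(2) by simp
    qed
    assume \<psi>: "\<bar>\<psi>\<bar> < pi/2"
    then have cp: "cos \<psi> > 0" by (auto intro: cos_gt_zero_pi)
    have "dt U (t, \<psi>, \<theta>) = S2_laplacian (\<lambda>\<psi>' \<theta>'. L (t, \<psi>', \<theta>')) \<psi> \<theta> - 2"
      using DERIV_unique[OF has_dir_deriv(1)[OF CU t] U(4)[OF t \<psi>]] by (simp add: L_def)
    also have "\<dots> = d\<psi> (d\<psi> L) (t, \<psi>, \<theta>) - tan \<psi> * d\<psi> L (t, \<psi>, \<theta>)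
        + (1 / cos \<psi>)\<^sup>2 * d\<theta> (d\<theta> L) (t, \<psi>, \<theta>) - 2"
      unfolding S2_laplacian_def Ld DERIV_imp_deriv[OF has_dir_deriv(2)[OF C1 t]]
        DERIV_imp_deriv[OF has_dir_deriv(3)[OF C1 t]] ..
    finally show "cos \<psi> * dt U (t, \<psi>, \<theta>) = cos \<psi> * d\<psi> (d\<psi> L) (t, \<psi>, \<theta>)
        - sin \<psi> * d\<psi> L (t, \<psi>, \<theta>) + d\<theta> (d\<theta> L) (t, \<psi>, \<theta>) / cos \<psi> - 2 * cos \<psi>"
      using cp by (simp add: tan_def field_simps power2_eq_square)
  }
qed

abbreviation latlon_box :: "(real \<times> real) set" where
  "latlon_box \<equiv> {-pi/2..pi/2} \<times> {0..2*pi}"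

text \<open>Used twice: with a vanishing right-hand side it is the comparison principle, and with a
  right-hand side that tends to 0 as \<open>t0\<close> goes to minus infinity it yields rotation
  invariance.\<close>

lemma ancient_flow_contraction:
  assumes U: "ancient_flow U" and V: "ancient_flow V" and t: "t0 \<le> t1" "t1 < 0"
  shows "integral latlon_box (\<lambda>x. cos (fst x) * max 0 (U (t1, x) - V (t1, x)))
    \<le> integral latlon_box (\<lambda>x. cos (fst x) * max 0 (U (t0, x) - V (t0, x)))"
proof -
  note UD = ancient_flowD[OF U] and VD = ancient_flowD[OF V]
  define L where "L x = ln (U x)" for x
  define M where "M x = ln (V x)" for x
  note L = ancient_flow_log[OF U, folded L_def] and M = ancient_flow_log[OF V, folded M_def]
  have C2: "C_diff_on (Suc 1) U past" "C_diff_on (Suc 1) V past" "C_diff_on (Suc 1) L past" "C_diff_on (Suc 1) M past"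
    using UD(1) VD(1) L(1) M(1) by (simp_all add: numeral_2_eq_2)
  have C1: "C_diff_on (Suc 0) (dir_deriv d L) past" "C_diff_on (Suc 0) (dir_deriv d M) past"
    "C_diff_on (Suc 0) (dir_deriv d U) past" "C_diff_on (Suc 0) (dir_deriv d V) past" for d
    using C2[THEN C_diff_on_dir_deriv] by auto
  have C0: "C_diff_on 0 (dir_deriv d' (dir_deriv d L)) past" "C_diff_on 0 (dir_deriv d' (dir_deriv d M)) past" for d d'
    using C1[THEN C_diff_on_dir_deriv] by auto
  have sub: "continuous_on ({t0..t1} \<times> latlon_box) f" if "C_diff_on k f past" for f :: "real \<times> real \<times> real \<Rightarrow> real" and k
    by (rule continuous_on_subset[OF C_diff_on_imp_continuous_on[OF that]]) (use t in auto)
  have neg: "s < 0" if "s \<in> {t0..t1}" for s using that t by auto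
  show ?thesis
  proof (rule positive_part_integral_decreasing[where
        D = "\<lambda>x. U x - V x" and Dt = "\<lambda>x. dt U x - dt V x" and W = "\<lambda>x. L x - M x"
        and Wp = "\<lambda>x. d\<psi> L x - d\<psi> M x" and Wpp = "\<lambda>x. d\<psi> (d\<psi> L) x - d\<psi> (d\<psi> M) x"
        and Wq = "\<lambda>x. d\<theta> L x - d\<theta> M x" and Wqq = "\<lambda>x. d\<theta> (d\<theta> L) x - d\<theta> (d\<theta> M) x", OF t(1)])
    fix s \<psi> :: real assume s: "s \<in> {t0..t1}"
    show "L (s, \<psi>, 2*pi) - M (s, \<psi>, 2*pi) = L (s, \<psi>, 0) - M (s, \<psi>, 0)"
      using UD(3)[OF neg[OF s], of \<psi> 0] VD(3)[OF neg[OF s], of \<psi> 0] by (simp add: L_def M_def)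
    show "d\<theta> L (s, \<psi>, 2*pi) - d\<theta> M (s, \<psi>, 2*pi) = d\<theta> L (s, \<psi>, 0) - d\<theta> M (s, \<psi>, 0)"
      using L(2)[OF neg[OF s]] M(2)[OF neg[OF s]] by simp
    fix \<theta> assume \<psi>: "\<bar>\<psi>\<bar> < pi/2"
    show "cos \<psi> * (dt U (s, \<psi>, \<theta>) - dt V (s, \<psi>, \<theta>)) =
        cos \<psi> * (d\<psi> (d\<psi> L) (s, \<psi>, \<theta>) - d\<psi> (d\<psi> M) (s, \<psi>, \<theta>))
        - sin \<psi> * (d\<psi> L (s, \<psi>, \<theta>) - d\<psi> M (s, \<psi>, \<theta>))
        + (d\<theta> (d\<theta> L) (s, \<psi>, \<theta>) - d\<theta> (d\<theta> M) (s, \<psi>, \<theta>)) / cos \<psi>"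
      using L(3)[OF neg[OF s] \<psi>, of \<theta>] M(3)[OF neg[OF s] \<psi>, of \<theta>]
      by (simp add: right_diff_distrib diff_divide_distrib)
  next
    fix s x assume "s \<in> {t0..t1}" "x \<in> latlon_box"
    then show "U (s, x) - V (s, x) > 0 \<longleftrightarrow> L (s, x) - M (s, x) > 0"
      using UD(2) VD(2) neg by (simp add: L_def M_def)
  next
    fix s x assume s: "s \<in> {t0..t1}"
    show "((\<lambda>s. U (s, x) - V (s, x)) has_real_derivative dt U (s, x) - dt V (s, x)) (at s)"
      using DERIV_diff[OF has_dir_deriv(1)[OF C2(1) neg[OF s]] has_dir_deriv(1)[OF C2(2) neg[OF s]],
          of "fst x" "snd x" "fst x" "snd x"] by simp
  qed (intro DERIV_diff has_dir_deriv[OF C2(3)] has_dir_deriv[OF C2(4)] has_dir_deriv[OF C1(1)]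
      has_dir_deriv[OF C1(2)] neg continuous_on_diff sub[OF C2(1)] sub[OF C2(2)] sub[OF C2(3)] sub[OF C2(4)]
      sub[OF C1(1)] sub[OF C1(2)] sub[OF C1(3)] sub[OF C1(4)] sub[OF C0(1)] sub[OF C0(2)]; assumption)+
qed

text \<open>A continuous nonnegative function with integral 0 vanishes, and the weight is positive
  between the poles.\<close>

lemma cos_weight_integral_zero_imp:
  assumes f: "continuous_on latlon_box f" "\<And>x. 0 \<le> f x"
    and int: "integral latlon_box (\<lambda>x. cos (fst x) * f x) \<le> 0"
    and \<psi>: "\<bar>\<psi>\<bar> < pi/2" "\<theta> \<in> {0..2*pi}"
  shows "f (\<psi>, \<theta>) = 0"
proof -
  have B: "latlon_box = cbox (-pi/2, 0) (pi/2, 2*pi)" by (simp add: cbox_Pair_eq)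
  have c: "continuous_on latlon_box (\<lambda>x. cos (fst x) * f x)"
    by (intro continuous_intros f)
  have nn: "0 \<le> cos (fst x) * f x" if "x \<in> latlon_box" for x
    using that f(2) by (auto intro!: mult_nonneg_nonneg cos_ge_zero)
  have i: "(\<lambda>x. cos (fst x) * f x) integrable_on latlon_box"
    using c unfolding B by (rule integrable_continuous)
  have "integral latlon_box (\<lambda>x. cos (fst x) * f x) = 0"
    using integral_nonneg[OF i nn] int by simp
  then have "((\<lambda>x. cos (fst x) * f x) has_integral 0) (cbox (-pi/2, 0) (pi/2, 2*pi))"
    using integrable_integral[OF i] by (simp only: B)
  moreover have "box (-pi/2, 0) (pi/2, 2*pi) \<noteq> ({} :: (real \<times> real) set)"
    using box_eq_empty by (auto simp: box_ne_empty Basis_prod_def)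
  ultimately have "cos (fst (\<psi>, \<theta>)) * f (\<psi>, \<theta>) = 0"
    using has_integral_0_cbox_imp_0[OF c[unfolded B] _ _ _, of "(\<psi>, \<theta>)"] nn \<psi> box_subset_cbox B
    by (smt (verit) SigmaI atLeastAtMost_iff field_sum_of_halves subsetD)
  moreover have "cos \<psi> > 0" using \<psi> by (auto intro: cos_gt_zero_pi)
  ultimately show ?thesis by simp
qed

lemma ancient_flow_comparison:
  assumes U: "ancient_flow U" and V: "ancient_flow V" and t: "t0 \<le> t1" "t1 < 0"
    and le: "\<And>x. U (t0, x) \<le> V (t0, x)"
    and \<psi>: "\<bar>\<psi>\<bar> < pi/2" "\<theta> \<in> {0..2*pi}"
  shows "U (t1, \<psi>, \<theta>) \<le> V (t1, \<psi>, \<theta>)"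
proof -
  have "continuous_on latlon_box (\<lambda>x. W (t1, x))" if "ancient_flow W" for W
    using continuous_on_slice[OF ancient_flowD(5)[OF that]] t by (auto intro: continuous_on_subset)
  moreover have "max 0 (U (t0, x) - V (t0, x)) = 0" for x using le[of x] by simp
  ultimately have "max 0 (U (t1, \<psi>, \<theta>) - V (t1, \<psi>, \<theta>)) = 0"
    using ancient_flow_contraction[OF U V t] U V
    by (intro cos_weight_integral_zero_imp[OF _ _ _ \<psi>, of "\<lambda>x. max 0 (U (t1, x) - V (t1, x))"])
      (auto intro!: continuous_intros)
  then show ?thesis by simp
qed

section \<open>Monotonicity in time\<close>

text \<open>Both symmetries used below, parabolic rescaling and rotation, are affine changes of the
  variables \<open>(t, \<psi>, \<theta>)\<close>.\<close>

lemma C_diff_on_affine: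
  fixes A :: "'a::euclidean_space \<Rightarrow> 'b::euclidean_space"
  assumes "open S" "open T" "C_diff_on k F T" "bounded_linear A" "(\<lambda>x. c + A x) ` S \<subseteq> T"
  shows "C_diff_on k (\<lambda>x. F (c + A x)) S"
proof (rule C_diff_on_compose[OF assms(1,2,5,3)])
  fix b :: 'b
  have "bounded_linear (\<lambda>x. A x \<bullet> b)"
    using bounded_linear_compose[OF bounded_linear_inner_left assms(4)] .
  then show "C_diff_on k (\<lambda>x. (c + A x) \<bullet> b) S"
    unfolding inner_add_left using assms(1)
    by (intro C_diff_on_add C_diff_on_const C_diff_on_bounded_linear)
qed

lemma S2_laplacian_add_const: "S2_laplacian (\<lambda>\<psi> \<theta>. c + f \<psi> \<theta>) = S2_laplacian f"
  by (simp add: S2_laplacian_def[abs_def] deriv_add_const)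

lemma S2_laplacian_rotate: "S2_laplacian (\<lambda>\<psi> \<theta>. f \<psi> (\<theta> + h)) \<psi> \<theta> = S2_laplacian f \<psi> (\<theta> + h)"
proof -
  have "deriv (\<lambda>s. f \<psi> (s + h)) = (\<lambda>s. deriv (f \<psi>) (s + h))"
    by (rule ext) (rule deriv_shift)
  then have "deriv (deriv (\<lambda>s. f \<psi> (s + h))) \<theta> = deriv (deriv (f \<psi>)) (\<theta> + h)"
    by (simp add: deriv_shift)
  then show ?thesis by (simp add: S2_laplacian_def)
qed

text \<open>The factor \<open>1 / l\<close> from the time variable cancels the \<open>l\<close> in
  front, and the logarithm changes only by the constant \<open>ln l\<close>, which the Laplacian
  does not see.\<close>

lemma ancient_flow_rescale:
  assumes U: "ancient_flow U" and t0: "t0 < 0" and l: "l > 1"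
  shows "ancient_flow (\<lambda>x. l * U (t0 + (fst x - t0) / l, snd x))"
proof -
  note UD = ancient_flowD[OF U]
  \<comment> \<open>The rescaled time is a convex combination of \<open>t0\<close> and
    \<open>t\<close>, with weight \<open>1 / l\<close> on \<open>t\<close>.\<close>
  have neg: "t0 + (t - t0) / l < 0" if "t < 0" for t
  proof -
    have "l * (t0 + (t - t0) / l) = (l - 1) * t0 + t" using l by (simp add: field_simps)
    also have "\<dots> < 0" using l t0 that by (intro add_neg_neg mult_pos_neg) auto
    finally show ?thesis using l by (simp add: mult_less_0_iff)
  qed
  define A :: "real \<times> real \<times> real \<Rightarrow> real \<times> real \<times> real" where "A x = (fst x / l, snd x)" for x
  define c :: "real \<times> real \<times> real" where "c = (t0 - t0 / l, 0)"
  have eq: "(t0 + (fst x - t0) / l, snd x) = c + A x" for x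
    by (simp add: A_def c_def diff_divide_distrib)
  have "bounded_linear A"
    unfolding A_def
    by (intro bounded_linear_Pair bounded_linear_snd bounded_linear_compose[OF bounded_linear_divide bounded_linear_fst])
  moreover have "(\<lambda>x. c + A x) ` past \<subseteq> past"
    unfolding eq[symmetric] using neg by auto
  ultimately have "C_diff_on 2 (\<lambda>x. l * U (c + A x)) past"
    using UD(1) open_past by (intro C_diff_on_mult C_diff_on_const C_diff_on_affine)
  moreover have "((\<lambda>s. l * U (t0 + (s - t0) / l, \<psi>, \<theta>)) has_real_derivative
      S2_laplacian (\<lambda>\<psi>' \<theta>'. ln (l * U (t0 + (t - t0) / l, \<psi>', \<theta>'))) \<psi> \<theta> - 2) (at t)"
    if t: "t < 0" and \<psi>: "\<bar>\<psi>\<bar> < pi/2" for t \<psi> \<theta>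
  proof -
    have "ln (l * U (t0 + (t - t0) / l, x)) = ln l + ln (U (t0 + (t - t0) / l, x))" for x
      using UD(2)[OF neg[OF t], of x] l by (simp add: ln_mult)
    then have "S2_laplacian (\<lambda>\<psi>' \<theta>'. ln (l * U (t0 + (t - t0) / l, \<psi>', \<theta>'))) \<psi> \<theta>
        = S2_laplacian (\<lambda>\<psi>' \<theta>'. ln (U (t0 + (t - t0) / l, \<psi>', \<theta>'))) \<psi> \<theta>"
      by (simp add: S2_laplacian_add_const)
    moreover have "((\<lambda>s. t0 + (s - t0) / l) has_real_derivative 1 / l) (at t)"
      using l by (auto intro!: derivative_eq_intros)
    from DERIV_cmult[OF DERIV_chain2[OF UD(4)[OF neg[OF t] \<psi>, of \<theta>] this], of l]
    have "((\<lambda>s. l * U (t0 + (s - t0) / l, \<psi>, \<theta>)) has_real_derivative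
        S2_laplacian (\<lambda>\<psi>' \<theta>'. ln (U (t0 + (t - t0) / l, \<psi>', \<theta>'))) \<psi> \<theta> - 2) (at t)"
      using l by simp
    ultimately show ?thesis by simp
  qed
  ultimately show ?thesis
    using UD(2,3) neg l unfolding ancient_flow_def eq[symmetric] by simp
qed

lemma ancient_flow_rotate:
  assumes U: "ancient_flow U"
  shows "ancient_flow (\<lambda>x. U (fst x, fst (snd x), snd (snd x) + h))"
proof -
  note UD = ancient_flowD[OF U]
  have eq: "(fst x, fst (snd x), snd (snd x) + h) = (0, 0, h) + x" for x :: "real \<times> real \<times> real"
    by (cases x) simp
  have "C_diff_on 2 (\<lambda>x. U ((0, 0, h) + x)) past"
    using UD(1) open_past by (intro C_diff_on_affine bounded_linear_ident) auto
  then have "C_diff_on 2 (\<lambda>x. U (fst x, fst (snd x), snd (snd x) + h)) past"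
    by (simp only: eq)
  moreover have "U (t, \<psi>, \<theta> + 2*pi + h) = U (t, \<psi>, \<theta> + h)" if "t < 0" for t \<psi> \<theta>
    using UD(3)[OF that, of \<psi> "\<theta> + h"] by (simp add: add_ac)
  moreover have "((\<lambda>s. U (s, \<psi>, \<theta> + h)) has_real_derivative
      S2_laplacian (\<lambda>\<psi>' \<theta>'. ln (U (t, \<psi>', \<theta>' + h))) \<psi> \<theta> - 2) (at t)"
    if "t < 0" "\<bar>\<psi>\<bar> < pi/2" for t \<psi> \<theta>
    using UD(4)[OF that, of "\<theta> + h"] S2_laplacian_rotate[of "\<lambda>\<psi> \<theta>. ln (U (t, \<psi>, \<theta>))" h] by simp
  ultimately show ?thesis using UD(2) unfolding ancient_flow_def by simp
qed

text \<open>
  The comparison of \<open>U\<close> with its rescaling about \<open>t0\<close> yields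
  \<open>U t \<le> (t - t0) / (s - t0) * U s\<close>, and \<open>t0\<close> may tend to \<open>-\<infinity>\<close>.
\<close>

lemma ancient_flow_antimono:
  assumes U: "ancient_flow U" and st: "s < t" "t < 0"
    and \<psi>: "\<bar>\<psi>\<bar> < pi/2" "\<theta> \<in> {0..2*pi}"
  shows "U (t, \<psi>, \<theta>) \<le> U (s, \<psi>, \<theta>)"
proof -
  have le: "U (t, \<psi>, \<theta>) \<le> (1 + (t - s) * (1 / real (Suc n))) * U (s, \<psi>, \<theta>)" for n
  proof -
    define t0 where "t0 = s - real (Suc n)"
    \<comment> \<open>With this ratio the rescaled flow at time \<open>t\<close> shows
      \<open>U\<close> at time \<open>s\<close>. By the choice of \<open>t0\<close> the denominator
      is \<open>n + 1\<close>, so \<open>l\<close> tends to 1 as \<open>n\<close> grows.\<close>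
    define l where "l = (t - t0) / (s - t0)"
    have t0: "t0 < s" by (simp add: t0_def)
    then have l: "l > 1" "l = 1 + (t - s) * (1 / real (Suc n))" "t0 + (t - t0) / l = s"
      using st by (auto simp: l_def t0_def field_simps)
    have "U (t, \<psi>, \<theta>) \<le> (\<lambda>x. l * U (t0 + (fst x - t0) / l, snd x)) (t, \<psi>, \<theta>)"
    proof (rule ancient_flow_comparison[OF U ancient_flow_rescale[OF U _ l(1)] _ _ _ \<psi>])
      \<comment> \<open>The rescaling fixes the time \<open>t0\<close>, so \<open>l > 1\<close> and
        positivity suffice.\<close>
      show "U (t0, x) \<le> l * U (t0 + (fst (t0, x) - t0) / l, snd (t0, x))" for x
        using ancient_flowD(2)[OF U, of t0 x] st t0 l(1) by simp
    qed (use st t0 in auto)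
    then show ?thesis using l by simp
  qed
  have "(\<lambda>n. (1 + (t - s) * (1 / real (Suc n))) * U (s, \<psi>, \<theta>)) \<longlonglongrightarrow> (1 + (t - s) * 0) * U (s, \<psi>, \<theta>)"
    by (intro tendsto_intros LIMSEQ_Suc[OF lim_1_over_n])
  then show ?thesis using LIMSEQ_le_const[of _ _ "U (t, \<psi>, \<theta>)"] le by fastforce
qed

text \<open>By \<open>ancient_flow_antimono\<close> the reciprocal is nondecreasing in time, so its
  limit at minus infinity bounds it from below at every time.\<close>

lemma ancient_flow_upper_bound:
  assumes U: "ancient_flow U" and t: "t < 0" and "L > 0"
    and \<psi>: "\<bar>\<psi>\<bar> < pi/2" "\<theta> \<in> {0..2*pi}"
    and lim: "((\<lambda>s. 1 / U (s, \<psi>, \<theta>)) \<longlongrightarrow> L) at_bot"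
  shows "U (t, \<psi>, \<theta>) \<le> 1 / L"
proof -
  have pos: "U (s, \<psi>, \<theta>) > 0" if "s \<le> t" for s using ancient_flowD(2)[OF U] that t by auto
  have "\<forall>\<^sub>F s in at_bot. 1 / U (s, \<psi>, \<theta>) \<le> 1 / U (t, \<psi>, \<theta>)"
  proof (rule eventually_mono[OF eventually_gt_at_bot[of t]])
    fix s assume "s < t"
    then show "1 / U (s, \<psi>, \<theta>) \<le> 1 / U (t, \<psi>, \<theta>)"
      using ancient_flow_antimono[OF U _ t \<psi>] pos by (intro divide_left_mono) auto
  qed
  then have "L \<le> 1 / U (t, \<psi>, \<theta>)"
    using tendsto_upperbound[OF lim] by simp
  then show ?thesis using pos[of t] assms(3) by (simp add: field_simps)
qed

text \<open>The equation, the limit and the oscillation bound are given on one period only, while a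
  rotation leaves it. The value type is arbitrary because \<open>f\<close> will be a predicate in
  one use and a map into functions of time in another.\<close>

lemma periodic_reduce:
  fixes f :: "real \<Rightarrow> 'a"
  assumes "\<And>x. f (x + 2*pi) = f x"
  obtains y where "y \<in> {0..2*pi}" "f y = f x"
proof -
  have nat: "f (x + real n * (2*pi)) = f x" for x n
  proof (induction n)
    case (Suc n)
    have "f (x + real (Suc n) * (2*pi)) = f (x + real n * (2*pi) + 2*pi)" by (simp add: algebra_simps)
    then show ?case using assms Suc by simp
  qed simp
  define k where "k = \<lfloor>x / (2*pi)\<rfloor>"
  define y where "y = x - of_int k * (2*pi)"
  have "of_int k \<le> x / (2*pi)" "x / (2*pi) < of_int k + 1"
    unfolding k_def by linarith+
  then have "y \<in> {0..2*pi}" by (auto simp: y_def field_simps)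
  moreover have "f y = f x"
  proof (cases "k \<ge> 0")
    case True
    then show ?thesis using nat[of y "nat k"] by (simp add: y_def)
  next
    case False
    then show ?thesis using nat[of x "nat (- k)"] by (simp add: y_def)
  qed
  ultimately show thesis by (rule that)
qed

text \<open>In \<open>cos^2 = (1 + sin) (1 - sin)\<close> each factor vanishes at one pole only and
  is at least 1 on the opposite hemisphere, where its power with exponent
  \<open>b - 1 \<le> 0\<close> is at most 1; so the product of the two powers is at most their sum.
  The sum, unlike the power of \<open>cos \<psi>\<close>, has an explicit primitive after
  weighting.\<close>

lemma cos_powr_bound:
  assumes "\<bar>\<psi>\<bar> < pi/2" "0 < b" "b \<le> 1" "2 * b \<le> a"
  shows "cos \<psi> powr (a - 2) \<le> (1 + sin \<psi>) powr (b - 1) + (1 - sin \<psi>) powr (b - 1)"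
proof -
  have c: "0 < cos \<psi>" "cos \<psi> \<le> 1" using assms(1) by (auto intro: cos_gt_zero_pi)
  have "(cos \<psi>)\<^sup>2 = (1 + sin \<psi>) * (1 - sin \<psi>)"
    by (simp add: cos_squared_eq algebra_simps power2_eq_square)
  moreover have "0 < (cos \<psi>)\<^sup>2" using c by simp
  ultimately have s: "0 < 1 + sin \<psi>" "0 < 1 - sin \<psi>"
    and eq: "(cos \<psi>)\<^sup>2 = (1 + sin \<psi>) * (1 - sin \<psi>)"
    using sin_le_one[of \<psi>] sin_ge_minus_one[of \<psi>] by (auto simp: zero_less_mult_iff)
  define x where "x = (1 + sin \<psi>) powr (b - 1)"
  define y where "y = (1 - sin \<psi>) powr (b - 1)"
  have pos: "x > 0" "y > 0" using s by (auto simp: x_def y_def)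
  have "cos \<psi> powr (a - 2) \<le> cos \<psi> powr (2 * (b - 1))"
    using c assms(4) by (intro powr_mono') auto
  also have "\<dots> = (cos \<psi> powr 2) powr (b - 1)" by (simp only: powr_powr)
  also have "\<dots> = ((cos \<psi>)\<^sup>2) powr (b - 1)" using c by simp
  also have "\<dots> = x * y" unfolding eq x_def y_def using s by (simp add: powr_mult)
  also have "\<dots> \<le> x + y"
  proof (cases "sin \<psi> \<ge> 0")
    case True
    then have "x \<le> 1" using assms(3) s powr_mono2'[of "b - 1" 1 "1 + sin \<psi>"] unfolding x_def by simp
    then have "x * y \<le> 1 * y" using pos by (intro mult_right_mono) auto
    then show ?thesis using pos by linarith
  next
    case False
    then have "y \<le> 1" using assms(3) s powr_mono2'[of "b - 1" 1 "1 - sin \<psi>"] unfolding y_def by simp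
    then have "x * y \<le> x * 1" using pos by (intro mult_left_mono) auto
    then show ?thesis using pos by linarith
  qed
  finally show ?thesis by (simp add: x_def y_def)
qed

text \<open>For \<open>b > 0\<close> the primitive \<open>f\<close> is continuous up to the poles
  although the integrand may be unbounded there, and the fundamental theorem asks for the derivative
  in the interior only.\<close>

lemma cos_powr_bound_integrable:
  assumes "0 < b"
  shows "(\<lambda>\<psi>. cos \<psi> * ((1 + sin \<psi>) powr (b - 1) + (1 - sin \<psi>) powr (b - 1))) integrable_on {-pi/2..pi/2}"
proof -
  define f where "f \<psi> = ((1 + sin \<psi>) powr b - (1 - sin \<psi>) powr b) / b" for \<psi>
  have "continuous_on {-pi/2..pi/2} f"
  proof -
    have nonneg: "0 \<le> 1 + sin \<psi>" for \<psi> :: real using sin_ge_minus_one[of \<psi>] by linarith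
    have "continuous_on {-pi/2..pi/2} (\<lambda>\<psi>. (1 + sin \<psi>) powr b)"
      by (rule continuous_on_powr') (use assms in \<open>auto intro!: continuous_intros simp: nonneg\<close>)
    moreover have "continuous_on {-pi/2..pi/2} (\<lambda>\<psi>. (1 - sin \<psi>) powr b)"
      by (rule continuous_on_powr') (use assms in \<open>auto intro!: continuous_intros\<close>)
    ultimately show ?thesis
      unfolding f_def using assms by (intro continuous_on_divide continuous_on_diff) auto
  qed
  moreover have "(f has_real_derivative cos \<psi> * ((1 + sin \<psi>) powr (b - 1) + (1 - sin \<psi>) powr (b - 1))) (at \<psi>)"
    if "\<psi> \<in> {-pi/2<..<pi/2}" for \<psi>
  proof -
    have "sin \<psi> < sin (pi/2)" "sin (-pi/2) < sin \<psi>"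
      using that by (auto intro!: sin_monotone_2pi simp del: sin_pi_half sin_minus)
    then have pos: "0 < 1 + sin \<psi>" "0 < 1 - sin \<psi>" by auto
    have "((\<lambda>\<psi>. (1 + sin \<psi>) powr b) has_real_derivative b * (1 + sin \<psi>) powr (b - 1) * cos \<psi>) (at \<psi>)"
      by (rule DERIV_chain2[where g = "\<lambda>\<psi>. 1 + sin \<psi>", OF has_real_derivative_powr[OF pos(1)]]) (auto intro!: derivative_eq_intros)
    moreover have "((\<lambda>\<psi>. (1 - sin \<psi>) powr b) has_real_derivative b * (1 - sin \<psi>) powr (b - 1) * (- cos \<psi>)) (at \<psi>)"
      by (rule DERIV_chain2[where g = "\<lambda>\<psi>. 1 - sin \<psi>", OF has_real_derivative_powr[OF pos(2)]]) (auto intro!: derivative_eq_intros)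
    ultimately have "(f has_real_derivative (b * (1 + sin \<psi>) powr (b - 1) * cos \<psi>
        - b * (1 - sin \<psi>) powr (b - 1) * (- cos \<psi>)) / b) (at \<psi>)"
      unfolding f_def by (intro DERIV_cdivide DERIV_diff)
    then show ?thesis
      using assms by (simp add: algebra_simps add_divide_distrib)
  qed
  ultimately have "((\<lambda>\<psi>. cos \<psi> * ((1 + sin \<psi>) powr (b - 1) + (1 - sin \<psi>) powr (b - 1)))
      has_integral f (pi/2) - f (-pi/2)) {-pi/2..pi/2}"
    by (intro fundamental_theorem_of_calculus_interior)
      (auto simp: has_real_derivative_iff_has_vector_derivative)
  then show ?thesis by (rule has_integral_integrable)
qed

section \<open>Rotation invariance\<close>

text \<open>The flow is compared with its rotation \<open>V\<close>. Dominated convergence is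
  applied first in \<open>\<theta>\<close> at fixed \<open>\<psi>\<close>, where the majorant is
  constant, and then in \<open>\<psi>\<close>, where it is a multiple of \<open>H\<close>.\<close>

lemma ancient_flow_rotation_invariant:
  assumes U: "ancient_flow U" and "C0 > 0" "a > 0" "M \<ge> 0" "T0 < 0"
    and lim: "\<And>\<psi> \<theta>. \<bar>\<psi>\<bar> < pi/2 \<Longrightarrow> \<theta> \<in> {0..2*pi} \<Longrightarrow>
      ((\<lambda>t. 1 / U (t, \<psi>, \<theta>)) \<longlongrightarrow> C0 * (cos \<psi>)\<^sup>2) at_bot"
    and osc: "\<And>t \<psi> \<theta> \<theta>'. t \<le> T0 \<Longrightarrow> \<bar>\<psi>\<bar> < pi/2 \<Longrightarrow> \<theta> \<in> {0..2*pi} \<Longrightarrow> \<theta>' \<in> {0..2*pi} \<Longrightarrow>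
      U (t, \<psi>, \<theta>) - U (t, \<psi>, \<theta>') \<le> M * cos \<psi> powr (a - 2)"
    and t: "t < 0" and \<psi>: "\<bar>\<psi>\<bar> < pi/2" "\<theta> \<in> {0..2*pi}"
  shows "U (t, \<psi>, \<theta> + h) \<le> U (t, \<psi>, \<theta>)"
proof -
  define V where "V x = U (fst x, fst (snd x), snd (snd x) + h)" for x
  have V: "ancient_flow V" unfolding V_def[abs_def] by (rule ancient_flow_rotate[OF U])
  define g where "g t \<psi> \<theta> = cos \<psi> * max 0 (V (t, \<psi>, \<theta>) - U (t, \<psi>, \<theta>))" for t \<psi> \<theta>
  define J where "J t = integral latlon_box (\<lambda>x. cos (fst x) * max 0 (V (t, x) - U (t, x)))" for t
  have cW: "continuous_on latlon_box (\<lambda>x. W (t, x))" if "ancient_flow W" "t < 0" for W t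
    using continuous_on_slice[OF ancient_flowD(5)[OF that(1)]] that(2) by (auto intro: continuous_on_subset)
  have cg: "continuous_on latlon_box (\<lambda>(\<psi>, \<theta>). g t \<psi> \<theta>)" if "t < 0" for t
    unfolding g_def case_prod_unfold using cW[OF U that] cW[OF V that]
    by (auto intro!: continuous_intros)
  have J: "J t = integral {-pi/2..pi/2} (\<lambda>\<psi>. integral {0..2*pi} (g t \<psi>))" if "t < 0" for t
  proof -
    have B: "latlon_box = cbox (-pi/2, 0) (pi/2, 2*pi)" by (simp add: cbox_Pair_eq)
    have "J t = integral latlon_box (\<lambda>(\<psi>, \<theta>). g t \<psi> \<theta>)"
      unfolding J_def g_def by (rule integral_cong) auto
    then show ?thesis using integral_prod_continuous[OF cg[OF that, unfolded B]] unfolding B by simp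
  qed
  have osc': "V (t, \<psi>, \<theta>) - U (t, \<psi>, \<theta>) \<le> M * cos \<psi> powr (a - 2)"
    and lim': "((\<lambda>t. V (t, \<psi>, \<theta>) - U (t, \<psi>, \<theta>)) \<longlongrightarrow> 0) at_bot"
    if \<psi>: "\<bar>\<psi>\<bar> < pi/2" "\<theta> \<in> {0..2*pi}" and t: "t \<le> T0" for t \<psi> \<theta>
  proof -
    \<comment> \<open>One \<open>y\<close> has to serve all times, so \<open>periodic_reduce\<close>
      is applied to a map into functions of time. The value 0 for \<open>t \<ge> 0\<close> is there
      because periodicity is known for negative times only.\<close>
    define f where "f x = (\<lambda>t. if t < 0 then U (t, \<psi>, x) else 0)" for x
    have "f (x + 2*pi) = f x" for x
      using ancient_flowD(3)[OF U] by (auto simp: f_def)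
    then obtain y where y: "y \<in> {0..2*pi}" "f y = f (\<theta> + h)" by (rule periodic_reduce)
    then have eq: "V (t, \<psi>, \<theta>) = U (t, \<psi>, y)" if "t < 0" for t
      using that fun_cong[OF y(2)[unfolded f_def], of t] by (simp add: V_def)
    show "V (t, \<psi>, \<theta>) - U (t, \<psi>, \<theta>) \<le> M * cos \<psi> powr (a - 2)"
      using osc[OF t \<psi>(1) y(1) \<psi>(2)] eq[of t] t assms(5) by simp
    have "cos \<psi> > 0" using \<psi>(1) by (auto intro: cos_gt_zero_pi)
    then have "C0 * (cos \<psi>)\<^sup>2 \<noteq> 0" using assms(2) by simp
    from tendsto_inverse[OF lim[OF \<psi>(1)] this]
    have L: "((\<lambda>t. U (t, \<psi>, x)) \<longlongrightarrow> inverse (C0 * (cos \<psi>)\<^sup>2)) at_bot" if "x \<in> {0..2*pi}" for x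
      using that by simp
    have "((\<lambda>t. U (t, \<psi>, y) - U (t, \<psi>, \<theta>)) \<longlongrightarrow> 0) at_bot"
      using tendsto_diff[OF L[OF y(1)] L[OF \<psi>(2)]] by simp
    then show "((\<lambda>t. V (t, \<psi>, \<theta>) - U (t, \<psi>, \<theta>)) \<longlongrightarrow> 0) at_bot"
      by (rule Lim_transform_eventually)
        (use eq in \<open>auto intro!: eventually_mono[OF eventually_gt_at_bot[of 0]]\<close>)
  qed
  \<comment> \<open>Dominated convergence needs a sequence of times; starting at \<open>T0\<close>
    keeps every member in the range of \<open>osc\<close>.\<close>
  define s where "s n = T0 - real n" for n
  have s: "s n \<le> T0" "s n < 0" for n using assms(5) by (auto simp: s_def)
  have s_lim: "filterlim s at_bot sequentially"
    unfolding s_def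
    using filterlim_tendsto_add_at_top[OF tendsto_const filterlim_real_sequentially, of "- T0"]
    by (simp add: filterlim_uminus_at_bot)
  have g_bound: "0 \<le> g (s n) \<psi> \<theta> \<and> g (s n) \<psi> \<theta> \<le> cos \<psi> * (M * cos \<psi> powr (a - 2))"
    if \<psi>: "\<bar>\<psi>\<bar> < pi/2" "\<theta> \<in> {0..2*pi}" for n \<psi> \<theta>
  proof -
    have "cos \<psi> > 0" using \<psi>(1) by (auto intro: cos_gt_zero_pi)
    then show ?thesis
      unfolding g_def using osc'[OF \<psi> s(1), of n] assms(4) by (auto intro!: mult_left_mono)
  qed
  have int_g: "g t \<psi> integrable_on {0..2*pi}" if "t < 0" "\<psi> \<in> {-pi/2..pi/2}" for t \<psi>
    using continuous_on_slice[OF cg[OF that(1)] that(2)] by (simp add: integrable_continuous_real)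
  \<comment> \<open>The largest \<open>b\<close> that satisfies both upper bounds in
    \<open>cos_powr_bound\<close>.\<close>
  define b where "b = min (a / 2) 1"
  have b: "0 < b" "b \<le> 1" "2 * b \<le> a" using assms(3) by (auto simp: b_def)
  define H where "H \<psi> = cos \<psi> * ((1 + sin \<psi>) powr (b - 1) + (1 - sin \<psi>) powr (b - 1))" for \<psi>
  have "(\<lambda>n. integral {-pi/2..pi/2} (\<lambda>\<psi>. integral {0..2*pi} (g (s n) \<psi>))) \<longlonglongrightarrow>
      integral {-pi/2..pi/2} (\<lambda>\<psi>. 0)"
  proof (rule dominated_convergence(2)[where h = "\<lambda>\<psi>. 2 * pi * M * H \<psi>"])
    show "(\<lambda>\<psi>. integral {0..2*pi} (g (s n) \<psi>)) integrable_on {-pi/2..pi/2}" for n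
      using integral_continuous_on_param[of "{-pi/2..pi/2}" 0 "2*pi" "g (s n)"] cg[OF s(2)]
      by (intro integrable_continuous_real) simp
    show "(\<lambda>\<psi>. 2 * pi * M * H \<psi>) integrable_on {-pi/2..pi/2}"
      unfolding H_def by (intro integrable_on_mult_right cos_powr_bound_integrable b)
  next
    fix \<psi> :: real assume \<psi>: "\<psi> \<in> {-pi/2..pi/2}"
    have "(\<forall>n. norm (integral {0..2*pi} (g (s n) \<psi>)) \<le> 2 * pi * M * H \<psi>) \<and>
      (\<lambda>n. integral {0..2*pi} (g (s n) \<psi>)) \<longlonglongrightarrow> 0"
    proof (cases "\<bar>\<psi>\<bar> < pi/2")
      case True
      have cp: "cos \<psi> > 0" using True by (auto intro: cos_gt_zero_pi)
      have "norm (integral {0..2*pi} (g (s n) \<psi>)) \<le> 2 * pi * M * H \<psi>" for n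
      proof -
        have "norm (integral {0..2*pi} (g (s n) \<psi>)) \<le> integral {0..2*pi} (\<lambda>\<theta>. M * H \<psi>)"
        proof (rule integral_norm_bound_integral[OF int_g[OF s(2) \<psi>]])
          fix \<theta> assume \<theta>: "\<theta> \<in> {0..2*pi}"
          have "cos \<psi> * (M * cos \<psi> powr (a - 2)) \<le> M * H \<psi>"
            unfolding H_def using cos_powr_bound[OF True b] cp assms(4)
            by (simp add: mult.left_commute mult_left_mono)
          then show "norm (g (s n) \<psi> \<theta>) \<le> M * H \<psi>"
            using g_bound[OF True \<theta>, of n] by simp
        qed auto
        then show ?thesis by (simp add: mult_ac)
      qed
      moreover have "(\<lambda>n. integral {0..2*pi} (g (s n) \<psi>)) \<longlonglongrightarrow> integral {0..2*pi} (\<lambda>\<theta>. 0)"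
      proof (rule dominated_convergence(2)[where h = "\<lambda>\<theta>. cos \<psi> * (M * cos \<psi> powr (a - 2))"])
        show "(\<lambda>n. g (s n) \<psi> \<theta>) \<longlonglongrightarrow> 0" if "\<theta> \<in> {0..2*pi}" for \<theta>
        proof -
          have "(\<lambda>n. V (s n, \<psi>, \<theta>) - U (s n, \<psi>, \<theta>)) \<longlonglongrightarrow> 0"
            using filterlim_compose[OF lim'[OF True that order_refl] s_lim] .
          then have "(\<lambda>n. g (s n) \<psi> \<theta>) \<longlonglongrightarrow> cos \<psi> * max 0 0"
            unfolding g_def by (intro tendsto_intros)
          then show ?thesis by simp
        qed
        show "norm (g (s n) \<psi> \<theta>) \<le> cos \<psi> * (M * cos \<psi> powr (a - 2))" if "\<theta> \<in> {0..2*pi}" for n \<theta>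
          using g_bound[OF True that, of n] by simp
      qed (auto intro: int_g[OF s(2) \<psi>])
      ultimately show ?thesis by simp
    next
      case False
      then have "\<psi> = pi/2 \<or> \<psi> = - (pi/2)" using \<psi> by auto
      then have "cos \<psi> = 0" by (elim disjE) (simp_all only: cos_pi_half cos_minus)
      then show ?thesis by (simp add: g_def[abs_def] H_def)
    qed
    then show "norm (integral {0..2*pi} (g (s n) \<psi>)) \<le> 2 * pi * M * H \<psi>"
      and "(\<lambda>n. integral {0..2*pi} (g (s n) \<psi>)) \<longlonglongrightarrow> 0" for n by blast+
  qed
  then have "(\<lambda>n. J (s n)) \<longlonglongrightarrow> 0" using J[OF s(2)] by simp
  moreover have "\<forall>\<^sub>F n in sequentially. J t \<le> J (s n)"
  proof -
    \<comment> \<open>The given \<open>t\<close> may lie on either side of \<open>T0\<close>; the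
      contraction applies as soon as \<open>s n\<close> has passed below it.\<close>
    have "\<forall>\<^sub>F n in sequentially. s n < t"
      using eventually_compose_filterlim[OF eventually_gt_at_bot[of t] s_lim] .
    then show ?thesis
      unfolding J_def by (rule eventually_mono) (intro ancient_flow_contraction[OF V U _ t] less_imp_le)
  qed
  ultimately have "J t \<le> 0" using tendsto_lowerbound by fastforce
  then have "max 0 (V (t, \<psi>, \<theta>) - U (t, \<psi>, \<theta>)) = 0"
    unfolding J_def using cW[OF U t] cW[OF V t]
    by (intro cos_weight_integral_zero_imp[OF _ _ _ \<psi>, of "\<lambda>x. max 0 (V (t, x) - U (t, x))"])
      (auto intro!: continuous_intros)
  then show ?thesis by (simp add: V_def)
qed

section \<open>From the sphere to latitude-longitude coordinates\<close>

lemma latlon_in_S2: "latlon \<psi> \<theta> \<in> S2"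
proof -
  have "(cos \<psi> * cos \<theta>)\<^sup>2 + (cos \<psi> * sin \<theta>)\<^sup>2 + (sin \<psi>)\<^sup>2 = (cos \<psi>)\<^sup>2 * ((cos \<theta>)\<^sup>2 + (sin \<theta>)\<^sup>2) + (sin \<psi>)\<^sup>2"
    by (simp only: power_mult_distrib distrib_left)
  then show ?thesis
    by (simp add: S2_def latlon_def norm_vec_def L2_set_def sum_3)
qed

lemma latlon_periodic: "latlon \<psi> (\<theta> + 2*pi) = latlon \<psi> \<theta>"
  by (simp add: latlon_def)

lemma latlon_pole: "cos \<psi> = 0 \<Longrightarrow> latlon \<psi> \<theta> = latlon \<psi> \<theta>'"
  by (simp add: latlon_def)

text \<open>The map \<open>\<Lambda>\<close> is smooth on the whole space with values in sphere
  times time, and locally the conformal factor is an ambient smooth extension composed with it. No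
  inverse chart occurs, so the poles need no separate treatment.\<close>

lemma C_diff_on_latlon:
  assumes "smooth_on (\<lambda>(p, t). u p t) (S2 \<times> {..<0})"
  shows "C_diff_on k (\<lambda>x. u (latlon (fst (snd x)) (snd (snd x))) (fst x)) past"
proof (rule C_diff_on_local)
  define \<Lambda> where "\<Lambda> x = (latlon (fst (snd x)) (snd (snd x)), fst x)" for x :: "real \<times> real \<times> real"
  have lin: "C_diff_on k (\<lambda>x :: real \<times> real \<times> real. fst (snd x)) UNIV" "C_diff_on k (\<lambda>x :: real \<times> real \<times> real. snd (snd x)) UNIV"
    "C_diff_on k (\<lambda>x :: real \<times> real \<times> real. fst x) UNIV" for k
    by (auto intro!: C_diff_on_bounded_linear bounded_linear_intros)
  have \<Lambda>: "C_diff_on k (\<lambda>x. \<Lambda> x \<bullet> b) UNIV" if "b \<in> Basis" for b k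
  proof -
    have sc: "C_diff_on k (\<lambda>x. sin (f x)) UNIV" "C_diff_on k (\<lambda>x. cos (f x)) UNIV"
      if "C_diff_on k f UNIV" for f :: "real \<times> real \<times> real \<Rightarrow> real"
      using C_diff_on_compose_real[OF open_UNIV open_UNIV subset_UNIV _ that] C_diff_on_sin_cos by auto
    have "C_diff_on k (\<lambda>x :: real \<times> real \<times> real. latlon (fst (snd x)) (snd (snd x)) $ i) UNIV" for i
      using exhaust_3[of i] sc[OF lin(1)] sc[OF lin(2)] unfolding latlon_def
      by (auto intro!: C_diff_on_mult)
    then show ?thesis
      using that lin(3) by (auto simp: Basis_prod_def Basis_vec_def \<Lambda>_def inner_axis)
  qed
  have "continuous_on UNIV (\<lambda>x. \<Lambda> x \<bullet> b)" if "b \<in> Basis" for b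
    using \<Lambda>[OF that, of 0] by simp
  then have cont: "continuous_on UNIV \<Lambda>"
    by (subst continuous_on_componentwise) auto
  fix x :: "real \<times> real \<times> real" assume x: "x \<in> past"
  have in_S2: "\<Lambda> y \<in> S2 \<times> {..<0}" if "y \<in> past" for y
    using that latlon_in_S2 by (auto simp: \<Lambda>_def)
  from assms in_S2[OF x] obtain W F where W: "open W" "\<Lambda> x \<in> W" "\<And>k. C_diff_on k F W"
    "\<And>p. p \<in> (S2 \<times> {..<0}) \<inter> W \<Longrightarrow> F p = (case p of (p, t) \<Rightarrow> u p t)"
    unfolding smooth_on_def by meson
  define T where "T = \<Lambda> -` W \<inter> past"
  have T: "open T" "x \<in> T"
    using open_vimage[OF W(1) cont] open_past x W(2) by (auto simp: T_def intro!: open_Int)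
  have smooth: "C_diff_on k (\<lambda>x. F (\<Lambda> x)) T"
    by (rule C_diff_on_compose[OF T(1) W(1) _ W(3)])
      (use C_diff_on_subset[OF \<Lambda> subset_UNIV] in \<open>auto simp: T_def\<close>)
  have ext: "F (\<Lambda> y) = u (latlon (fst (snd y)) (snd (snd y))) (fst y)" if "y \<in> T" for y
    using W(4)[of "\<Lambda> y"] in_S2[of y] that by (auto simp: T_def \<Lambda>_def)
  have "C_diff_on k (\<lambda>x. u (latlon (fst (snd x)) (snd (snd x))) (fst x)) T"
    by (rule C_diff_on_cong[OF T(1) ext smooth])
  then show "\<exists>T. open T \<and> x \<in> T \<and> C_diff_on k (\<lambda>x. u (latlon (fst (snd x)) (snd (snd x))) (fst x)) T"
    using T by blast
qed

theorem theorem3: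
  fixes u :: "real^3 \<Rightarrow> real \<Rightarrow> real"
    and v :: "real \<Rightarrow> real \<Rightarrow> real \<Rightarrow> real"
    and C\<^sub>0 a T\<^sub>0 C :: real
  assumes flow: "S2_ricci_flow u 0"
    and singular: "becomes_singular_at u 0"
    and pde: "\<And>\<psi> \<theta> t. \<bar>\<psi>\<bar> < pi / 2 \<Longrightarrow> 0 \<le> \<theta> \<Longrightarrow> \<theta> \<le> 2 * pi \<Longrightarrow> t < 0 \<Longrightarrow>
        ((\<lambda>s. u (latlon \<psi> \<theta>) s) has_real_derivative
           S2_laplacian (\<lambda>\<psi>' \<theta>'. ln (u (latlon \<psi>' \<theta>') t)) \<psi> \<theta> - 2) (at t)"
    and v_def: "v = (\<lambda>\<psi> \<theta> t. 1 / u (latlon \<psi> \<theta>) t)"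
    and C0_pos: "C\<^sub>0 > 0"
    and v_lim: "\<And>\<psi> \<theta>. \<bar>\<psi>\<bar> \<le> pi / 2 \<Longrightarrow> 0 \<le> \<theta> \<Longrightarrow> \<theta> \<le> 2 * pi \<Longrightarrow>
        ((\<lambda>t. v \<psi> \<theta> t) \<longlongrightarrow> C\<^sub>0 * (cos \<psi>)\<^sup>2) at_bot"
    and a: "0 < a" "a < 3"
    and T0: "T\<^sub>0 < 0"
    and C: "C > 0"
    and v_theta: "\<And>\<psi> \<theta> t. \<bar>\<psi>\<bar> \<le> pi / 2 \<Longrightarrow> 0 \<le> \<theta> \<Longrightarrow> \<theta> \<le> 2 * pi \<Longrightarrow> t \<le> T\<^sub>0 \<Longrightarrow>
        (deriv (\<lambda>\<theta>'. v \<psi> \<theta>' t) \<theta>)\<^sup>2 \<le> C * v \<psi> \<theta> t powr (1 + a) * (cos \<psi>)\<^sup>2"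
  shows "\<forall>\<psi> t. \<bar>\<psi>\<bar> \<le> pi / 2 \<and> t < 0 \<longrightarrow>
           (\<forall>\<theta>\<in>{0..2 * pi}. \<forall>\<theta>'\<in>{0..2 * pi}. u (latlon \<psi> \<theta>) t = u (latlon \<psi> \<theta>') t)"
proof -
  define U where "U x = u (latlon (fst (snd x)) (snd (snd x))) (fst x)" for x
  have U_eq: "U (t, \<psi>, \<theta>) = u (latlon \<psi> \<theta>) t" for t \<psi> \<theta> by (simp add: U_def)
  have smooth: "C_diff_on k U past" for k
    using flow C_diff_on_latlon unfolding S2_ricci_flow_def U_def[abs_def] by blast
  have U: "ancient_flow U"
    unfolding ancient_flow_def
  proof (intro conjI allI impI)
    show "U (t, x) > 0" if "t < 0" for t x
      using that flow latlon_in_S2 unfolding S2_ricci_flow_def U_def by simp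
    show "U (t, \<psi>, \<theta> + 2*pi) = U (t, \<psi>, \<theta>)" for t \<psi> \<theta>
      by (simp add: U_eq latlon_periodic)
    fix t \<psi> \<theta> :: real assume t: "t < 0" and \<psi>: "\<bar>\<psi>\<bar> < pi/2"
    \<comment> \<open>\<open>pde\<close> covers one period only. Both sides of the equation are
      periodic in \<open>\<theta>\<close>, so its validity is a periodic predicate and
      \<open>periodic_reduce\<close> applies to it.\<close>
    define P where "P \<theta> \<longleftrightarrow> ((\<lambda>s. U (s, \<psi>, \<theta>)) has_real_derivative
        S2_laplacian (\<lambda>\<psi>' \<theta>'. ln (U (t, \<psi>', \<theta>'))) \<psi> \<theta> - 2) (at t)" for \<theta>
    have "P (x + 2*pi) = P x" for x
      using S2_laplacian_rotate[of "\<lambda>\<psi>' \<theta>'. ln (U (t, \<psi>', \<theta>'))" "2*pi" \<psi> x]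
      by (simp add: P_def U_eq latlon_periodic)
    then obtain y where y: "y \<in> {0..2*pi}" "P y = P \<theta>" by (rule periodic_reduce)
    moreover have "P y" using pde[OF \<psi> _ _ t] y(1) by (simp add: P_def U_eq)
    ultimately show "((\<lambda>s. U (s, \<psi>, \<theta>)) has_real_derivative
        S2_laplacian (\<lambda>\<psi>' \<theta>'. ln (U (t, \<psi>', \<theta>'))) \<psi> \<theta> - 2) (at t)"
      by (simp add: P_def)
  qed (rule smooth)
  have lim: "((\<lambda>t. 1 / U (t, \<psi>, \<theta>)) \<longlongrightarrow> C\<^sub>0 * (cos \<psi>)\<^sup>2) at_bot"
    if "\<bar>\<psi>\<bar> < pi/2" "\<theta> \<in> {0..2*pi}" for \<psi> \<theta>
    using v_lim[of \<psi> \<theta>] that by (simp add: v_def U_eq)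
  \<comment> \<open>\<open>K\<^sup>2\<close> collects the constants left when the bound
    \<open>1 / (C\<^sub>0 * c\<^sup>2)\<close> for \<open>w\<close> is put into
    \<open>C * w powr (3 - a) * c\<^sup>2\<close>; the exponents of \<open>c\<close> add up to
    \<open>2 * (a - 2)\<close>.\<close>
  define K where "K = sqrt (C * (1 / C\<^sub>0) powr (3 - a))"
  have K: "K \<ge> 0" by (simp add: K_def C less_imp_le)
  have CU: "C_diff_on (Suc 0) U past" by (rule smooth)
  have d_bound: "\<bar>d\<theta> U (t, \<psi>, \<theta>)\<bar> \<le> K * cos \<psi> powr (a - 2)"
    if t: "t \<le> T\<^sub>0" and \<psi>: "\<bar>\<psi>\<bar> < pi/2" "\<theta> \<in> {0..2*pi}" for t \<psi> \<theta>
  proof -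
    have t0: "t < 0" using t T0 by simp
    define c where "c = cos \<psi>"
    define w where "w = U (t, \<psi>, \<theta>)"
    define D where "D = d\<theta> U (t, \<psi>, \<theta>)"
    have c: "c > 0" unfolding c_def using \<psi>(1) by (auto intro: cos_gt_zero_pi)
    have w: "w > 0" unfolding w_def by (rule ancient_flowD(2)[OF U t0])
    have "((\<lambda>\<theta>. v \<psi> \<theta> t) has_real_derivative - D / w\<^sup>2) (at \<theta>)"
    proof -
      have "((\<lambda>s. inverse (U (t, \<psi>, s))) has_real_derivative - (inverse w * D * inverse w)) (at \<theta>)"
        using DERIV_inverse'[OF has_dir_deriv(3)[OF CU t0, of \<psi> \<theta>]] w by (simp add: w_def D_def)
      then show ?thesis by (simp add: v_def U_eq divide_inverse power2_eq_square mult_ac)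
    qed
    then have "(D / w\<^sup>2)\<^sup>2 \<le> C * (1 / w) powr (1 + a) * c\<^sup>2"
      using v_theta[of \<psi> \<theta> t] t \<psi> DERIV_imp_deriv by (fastforce simp: v_def w_def U_eq c_def)
    then have "D\<^sup>2 \<le> C * (1 / w) powr (1 + a) * c\<^sup>2 * w ^ 4"
      using w by (simp add: power_divide pos_divide_le_eq flip: power_mult)
    also have "\<dots> = C * w powr (3 - a) * c\<^sup>2"
    proof -
      \<comment> \<open>The factor \<open>w ^ 4\<close> comes from squaring the denominator of
        \<open>- D / w\<^sup>2\<close>, the derivative of \<open>v\<close>.\<close>
      have "(1 / w) powr (1 + a) * w ^ 4 = w powr (- (1 + a)) * w powr 4"
        using w powr_minus_divide[of w "1 + a"] by (simp add: powr_divide del: minus_add_distrib)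
      also have "\<dots> = w powr (3 - a)" by (simp flip: powr_add)
      finally show ?thesis by (simp add: mult_ac)
    qed
    \<comment> \<open>Here \<open>a < 3\<close> enters: the exponent is positive, so an upper bound
      for \<open>w\<close> can be inserted.\<close>
    also have "\<dots> \<le> C * (1 / (C\<^sub>0 * c\<^sup>2)) powr (3 - a) * c\<^sup>2"
    proof -
      have "w \<le> 1 / (C\<^sub>0 * c\<^sup>2)"
        unfolding w_def c_def
        by (rule ancient_flow_upper_bound[OF U t0 _ \<psi> lim[OF \<psi>]]) (use C0_pos c in \<open>auto simp: c_def\<close>)
      then show ?thesis
        using w C a by (intro mult_right_mono mult_left_mono powr_mono2) auto
    qed
    also have "\<dots> = (K * c powr (a - 2))\<^sup>2"
    proof -
      have "(1 / (C\<^sub>0 * c\<^sup>2)) powr (3 - a) * c\<^sup>2 = (1 / C\<^sub>0) powr (3 - a) * ((1 / c\<^sup>2) powr (3 - a) * c\<^sup>2)"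
        using C0_pos c by (simp add: powr_mult powr_divide)
      also have "(1 / c\<^sup>2) powr (3 - a) * c\<^sup>2 = (c powr (-2)) powr (3 - a) * c powr 2"
        using c by (simp add: powr_minus inverse_eq_divide)
      also have "\<dots> = c powr ((a - 2) + (a - 2))"
        by (simp add: powr_powr flip: powr_add)
      also have "\<dots> = (c powr (a - 2))\<^sup>2" by (simp only: powr_add power2_eq_square)
      finally have "C * (1 / (C\<^sub>0 * c\<^sup>2)) powr (3 - a) * c\<^sup>2 = (C * (1 / C\<^sub>0) powr (3 - a)) * (c powr (a - 2))\<^sup>2"
        by (simp only: mult_ac)
      also have "\<dots> = K\<^sup>2 * (c powr (a - 2))\<^sup>2" using C by (simp add: K_def)
      finally show ?thesis by (simp add: power_mult_distrib)
    qed
    finally have "\<bar>D\<bar> \<le> \<bar>K * c powr (a - 2)\<bar>" by (simp add: abs_le_square_iff)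
    then show ?thesis using K by (simp add: D_def c_def)
  qed
  \<comment> \<open>Integrated form of \<open>d_bound\<close>: two longitudes in one period differ
    by at most \<open>2 * pi\<close>.\<close>
  have osc: "U (t, \<psi>, \<theta>) - U (t, \<psi>, \<theta>') \<le> (2 * pi * K) * cos \<psi> powr (a - 2)"
    if t: "t \<le> T\<^sub>0" and \<psi>: "\<bar>\<psi>\<bar> < pi/2" and \<theta>: "\<theta> \<in> {0..2*pi}" "\<theta>' \<in> {0..2*pi}" for t \<psi> \<theta> \<theta>'
  proof -
    have t0: "t < 0" using t T0 by simp
    have "\<bar>U (t, \<psi>, \<theta>) - U (t, \<psi>, \<theta>')\<bar> \<le> (K * cos \<psi> powr (a - 2)) * \<bar>\<theta> - \<theta>'\<bar>"
    proof (rule field_differentiable_bound[where S = "{0..2*pi}" and f' = "\<lambda>\<theta>. d\<theta> U (t, \<psi>, \<theta>)", unfolded real_norm_def])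
      show "((\<lambda>s. U (t, \<psi>, s)) has_real_derivative d\<theta> U (t, \<psi>, z)) (at z within {0..2*pi})" for z
        by (rule has_field_derivative_at_within[OF has_dir_deriv(3)[OF CU t0]])
    qed (use d_bound[OF t \<psi>] \<theta> in auto)
    also have "\<dots> \<le> (K * cos \<psi> powr (a - 2)) * (2*pi)"
      using \<theta> K by (intro mult_left_mono) auto
    finally show ?thesis by (simp add: mult_ac)
  qed
  \<comment> \<open>Rotation by \<open>\<theta> - \<theta>'\<close> gives one inequality; exchanging
    the two longitudes gives the other.\<close>
  have le: "u (latlon \<psi> \<theta>) t \<le> u (latlon \<psi> \<theta>') t"
    if "\<bar>\<psi>\<bar> < pi/2" "t < 0" "\<theta>' \<in> {0..2*pi}" for \<psi> \<theta> \<theta>' t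
    using ancient_flow_rotation_invariant[OF U C0_pos a(1) _ T0 lim osc that(2,1,3), of "\<theta> - \<theta>'"] K
    by (simp add: U_eq)
  show ?thesis
  proof (intro allI impI ballI)
    fix \<psi> t \<theta> \<theta>' :: real
    assume *: "\<bar>\<psi>\<bar> \<le> pi / 2 \<and> t < 0" "\<theta> \<in> {0..2 * pi}" "\<theta>' \<in> {0..2 * pi}"
    show "u (latlon \<psi> \<theta>) t = u (latlon \<psi> \<theta>') t"
    proof (cases "\<bar>\<psi>\<bar> < pi/2")
      case True
      then show ?thesis using le[OF True] * by (intro antisym) auto
    next
      case False
      then have "\<psi> = pi/2 \<or> \<psi> = - (pi/2)" using * by auto
      then have "cos \<psi> = 0" by (elim disjE) (simp_all only: cos_pi_half cos_minus)
      then show ?thesis using latlon_pole by metis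
    qed
  qed
qed

end
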